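(* Let $\mathcal{Q}$ be a small quantaloid. The assignment $\hat{\mathsf K}:\mathbf{Arr}(\mathcal{Q}\text{-}\mathbf{Dist})\to\mathcal{Q}\text{-}\mathbf{IntDist}$, which sends each arrow $(\zeta,\eta):(\phi:X\nrightarrow Y)\to(\psi:X'\nrightarrow Y')$ to the continuous $\mathcal{Q}$-distributor $\zeta:(X,\phi^*\phi_* )\nrightarrow(X',\psi^*\psi_* )$, is a full quantaloid homomorphism.
   Context: **Quantaloids.** A quantaloid is a (possibly large) category whose hom-sets are complete lattices and whose composition preserves arbitrary joins in each variable. For arrows $u:p\to q$, $v:q\to r$, $w:p\to r$ the arrows $w\swarrow u:q\to r$ and $v\searrow w:p\to q$ are determined by $v\circ u\le w\iff v\le w\swarrow u\iff u\le v\searrow w$. A homomorphism of quantaloids is a functor preserving joins of arrows; it is full if the underlying functor is full. A quantaloid is small if its objects form a set. Throughout, $\mathcal{Q}$ is a small quantaloid. **$\mathcal{Q}$-categories and $\mathcal{Q}$-distributors.** A $\mathcal{Q}$-category $X$ is a set $X$ with a type map $|\cdot|:X\to\mathrm{ob}\,\mathcal{Q}$ and hom-arrows $1_X^\natural(x,y)\in\mathcal{Q}(|x|,|y|)$ with $1_{|x|}\le 1_X^\natural(x,x)$ and $1_X^\natural(y,z)\circ 1_X^\natural(x,y)\le 1_X^\natural(x,z)$. Its underlying preorder is $x\le y\iff |x|=|y|$ and $1_{|x|}\le 1_X^\natural(x,y)$. A $\mathcal{Q}$-functor $f:X\to Y$ is a type-preserving map with $1_X^\natural(x,y)\le 1_Y^\natural(fx,fy)$;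 $\mathcal{Q}$-functors are ordered pointwise. A $\mathcal{Q}$-distributor $\phi:X\nrightarrow Y$ is a family $\phi(x,y)\in\mathcal{Q}(|x|,|y|)$ with $1_Y^\natural(y,y')\circ\phi(x,y)\circ 1_X^\natural(x',x)\le\phi(x',y')$. $\mathcal{Q}$-categories and $\mathcal{Q}$-distributors form a quantaloid $\mathcal{Q}\text{-}\mathbf{Dist}$ with pointwise order, $(\psi\circ\phi)(x,z)=\bigvee_y\psi(y,z)\circ\phi(x,y)$, identities $1_X^\natural$, and $(\xi\swarrow\phi)(y,z)=\bigwedge_x\xi(x,z)\swarrow\phi(x,y)$. **Presheaves and Kan adjunctions.** $\{q\}$ is the one-object $\mathcal{Q}$-category of type $q$ with hom $1_q$. $\mathsf{P}X$ is the $\mathcal{Q}$-category of all $\mathcal{Q}$-distributors $\mu:X\nrightarrow\{q\}$ (of type $q$; $q\in\mathrm{ob}\,\mathcal{Q}$), with $1_{\mathsf{P}X}^\natural(\mu,\mu')=\mu'\swarrow\mu$. Each $\phi:X\nrightarrow Y$ induces an adjunction $\phi^*\dashv\phi_*$ of $\mathcal{Q}$-functors, $\phi^*:\mathsf{P}Y\to\mathsf{P}X$, $\phi^*\lambda=\lambda\circ\phi$, and $\phi_*:\mathsf{P}X\to\mathsf{P}Y$, $\phi_*\mu=\mu\swarrow\phi$. **Interior spaces.** A $\mathcal{Q}$-interior space $(X,a)$ is a $\mathcal{Q}$-category $X$ with a $\mathcal{Q}$-functor $a:\mathsf{P}X\to\mathsf{P}X$ such that $a\le 1_{\mathsf{P}X}$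 and $aa=a$. A continuous $\mathcal{Q}$-distributor $\zeta:(X,a)\nrightarrow(Y,b)$ is a $\mathcal{Q}$-distributor $\zeta:X\nrightarrow Y$ with $\zeta^*b\le a\zeta^*$. $\mathcal{Q}\text{-}\mathbf{IntDist}$ is the quantaloid of $\mathcal{Q}$-interior spaces and continuous $\mathcal{Q}$-distributors (order, composition and identities as in $\mathcal{Q}\text{-}\mathbf{Dist}$). **Arrow quantaloid.** $\mathbf{Arr}(\mathcal{Q}\text{-}\mathbf{Dist})$ has $\mathcal{Q}$-distributors as objects; arrows from $\phi:X\nrightarrow Y$ to $\psi:X'\nrightarrow Y'$ are pairs $(\zeta:X\nrightarrow X',\eta:Y\nrightarrow Y')$ with $\psi\circ\zeta=\eta\circ\phi$, composed and ordered componentwise. On objects, $\hat{\mathsf K}$ sends $\phi:X\nrightarrow Y$ to $(X,\phi^*\phi_* )$. *)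

theory Defs
  imports "HOL-Algebra.Complete_Lattice" "HOL-Library.FuncSet"
begin

section \<open>Quantaloids\<close>

text \<open>
  Hom-sets are indexed by their end points and need not be disjoint, so composition
  takes the three objects involved as arguments: for arrows \<open>u : p \<rightarrow> q\<close> and
  \<open>v : q \<rightarrow> r\<close> the composite \<open>v \<circ> u : p \<rightarrow> r\<close> is \<open>Comp Q p q r v u\<close>.
  The objects form a set of some type, so all quantaloids here are small
  relative to the universe given by the types.
\<close>

record ('o, 'm) quantaloid_struct =
  Ob :: "'o set"
  Hom :: "'o \<Rightarrow> 'o \<Rightarrow> 'm gorder"
  Comp :: "'o \<Rightarrow> 'o \<Rightarrow> 'o \<Rightarrow> 'm \<Rightarrow> 'm \<Rightarrow> 'm"
  Idt :: "'o \<Rightarrow> 'm"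

abbreviation Arrows :: "('o, 'm) quantaloid_struct \<Rightarrow> 'o \<Rightarrow> 'o \<Rightarrow> 'm set" where
  "Arrows Q p q \<equiv> carrier (Hom Q p q)"

locale quantaloid =
  fixes Q :: "('o, 'm) quantaloid_struct"
  assumes hom_complete_lattice:
      "\<lbrakk>p \<in> Ob Q; q \<in> Ob Q\<rbrakk> \<Longrightarrow> complete_lattice (Hom Q p q)"
    and idt_closed: "p \<in> Ob Q \<Longrightarrow> Idt Q p \<in> Arrows Q p p"
    and comp_closed:
      "\<lbrakk>p \<in> Ob Q; q \<in> Ob Q; r \<in> Ob Q; u \<in> Arrows Q p q; v \<in> Arrows Q q r\<rbrakk>
        \<Longrightarrow> Comp Q p q r v u \<in> Arrows Q p r"
    and comp_idt_right:
      "\<lbrakk>p \<in> Ob Q; q \<in> Ob Q; u \<in> Arrows Q p q\<rbrakk> \<Longrightarrow> Comp Q p p q u (Idt Q p) = u"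
    and comp_idt_left:
      "\<lbrakk>p \<in> Ob Q; q \<in> Ob Q; u \<in> Arrows Q p q\<rbrakk> \<Longrightarrow> Comp Q p q q (Idt Q q) u = u"
    and comp_assoc:
      "\<lbrakk>p \<in> Ob Q; q \<in> Ob Q; r \<in> Ob Q; s \<in> Ob Q;
        u \<in> Arrows Q p q; v \<in> Arrows Q q r; w \<in> Arrows Q r s\<rbrakk>
        \<Longrightarrow> Comp Q p r s w (Comp Q p q r v u) = Comp Q p q s (Comp Q q r s w v) u"
    and comp_join_right:
      "\<lbrakk>p \<in> Ob Q; q \<in> Ob Q; r \<in> Ob Q; A \<subseteq> Arrows Q p q; v \<in> Arrows Q q r\<rbrakk>
        \<Longrightarrow> Comp Q p q r v (\<Squnion>\<^bsub>Hom Q p q\<^esub> A) = \<Squnion>\<^bsub>Hom Q p r\<^esub> ((\<lambda>u. Comp Q p q r v u) ` A)"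
    and comp_join_left:
      "\<lbrakk>p \<in> Ob Q; q \<in> Ob Q; r \<in> Ob Q; u \<in> Arrows Q p q; B \<subseteq> Arrows Q q r\<rbrakk>
        \<Longrightarrow> Comp Q p q r (\<Squnion>\<^bsub>Hom Q q r\<^esub> B) u = \<Squnion>\<^bsub>Hom Q p r\<^esub> ((\<lambda>v. Comp Q p q r v u) ` B)"

text \<open>For \<open>u : p \<rightarrow> q\<close> and \<open>w : p \<rightarrow> r\<close>, this is the arrow \<open>w \<swarrow> u : q \<rightarrow> r\<close>.\<close>

definition residual ::
  "('o, 'm) quantaloid_struct \<Rightarrow> 'o \<Rightarrow> 'o \<Rightarrow> 'o \<Rightarrow> 'm \<Rightarrow> 'm \<Rightarrow> 'm" where
  "residual Q p q r w u =
    (THE t. t \<in> Arrows Q q r \<and>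
      (\<forall>v \<in> Arrows Q q r. Comp Q p q r v u \<sqsubseteq>\<^bsub>Hom Q p r\<^esub> w \<longleftrightarrow> v \<sqsubseteq>\<^bsub>Hom Q q r\<^esub> t))"

locale quantaloid_hom = A: quantaloid A + B: quantaloid B
  for A :: "('o, 'm) quantaloid_struct" and B :: "('p, 'n) quantaloid_struct" +
  fixes F0 :: "'o \<Rightarrow> 'p" and F1 :: "'o \<Rightarrow> 'o \<Rightarrow> 'm \<Rightarrow> 'n"
  assumes map_ob: "p \<in> Ob A \<Longrightarrow> F0 p \<in> Ob B"
    and map_arrow:
      "\<lbrakk>p \<in> Ob A; q \<in> Ob A; u \<in> Arrows A p q\<rbrakk> \<Longrightarrow> F1 p q u \<in> Arrows B (F0 p) (F0 q)"
    and map_idt: "p \<in> Ob A \<Longrightarrow> F1 p p (Idt A p) = Idt B (F0 p)"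
    and map_comp:
      "\<lbrakk>p \<in> Ob A; q \<in> Ob A; r \<in> Ob A; u \<in> Arrows A p q; v \<in> Arrows A q r\<rbrakk>
        \<Longrightarrow> F1 p r (Comp A p q r v u) = Comp B (F0 p) (F0 q) (F0 r) (F1 q r v) (F1 p q u)"
    and map_join:
      "\<lbrakk>p \<in> Ob A; q \<in> Ob A; S \<subseteq> Arrows A p q\<rbrakk>
        \<Longrightarrow> F1 p q (\<Squnion>\<^bsub>Hom A p q\<^esub> S) = \<Squnion>\<^bsub>Hom B (F0 p) (F0 q)\<^esub> (F1 p q ` S)"

locale full_quantaloid_hom = quantaloid_hom +
  assumes full:
    "\<lbrakk>p \<in> Ob A; q \<in> Ob A; w \<in> Arrows B (F0 p) (F0 q)\<rbrakk>
      \<Longrightarrow> \<exists>u \<in> Arrows A p q. F1 p q u = w"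


section \<open>Categories and distributors enriched in a quantaloid\<close>

text \<open>
  Type maps, hom-families, distributors and functors are extensional functions
  (\<open>undefined\<close> off their domain), so that HOL equality is equality of these data.
\<close>

record ('a, 'o, 'm) qcat = "'a partial_object" +
  ty :: "'a \<Rightarrow> 'o"
  hm :: "'a \<Rightarrow> 'a \<Rightarrow> 'm"

definition families ::
  "('o, 'm) quantaloid_struct \<Rightarrow> ('a, 'o, 'm) qcat \<Rightarrow> ('b, 'o, 'm) qcat \<Rightarrow> ('a \<Rightarrow> 'b \<Rightarrow> 'm) set" where
  "families Q X Y = (\<Pi>\<^sub>E x \<in> carrier X. \<Pi>\<^sub>E y \<in> carrier Y. Arrows Q (ty X x) (ty Y y))"

definition qcategory :: "('o, 'm) quantaloid_struct \<Rightarrow> ('a, 'o, 'm) qcat \<Rightarrow> bool" where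
  "qcategory Q X \<longleftrightarrow>
    ty X \<in> carrier X \<rightarrow>\<^sub>E Ob Q \<and>
    hm X \<in> families Q X X \<and>
    (\<forall>x \<in> carrier X. Idt Q (ty X x) \<sqsubseteq>\<^bsub>Hom Q (ty X x) (ty X x)\<^esub> hm X x x) \<and>
    (\<forall>x \<in> carrier X. \<forall>y \<in> carrier X. \<forall>z \<in> carrier X.
      Comp Q (ty X x) (ty X y) (ty X z) (hm X y z) (hm X x y)
        \<sqsubseteq>\<^bsub>Hom Q (ty X x) (ty X z)\<^esub> hm X x z)"

definition under_le ::
  "('o, 'm) quantaloid_struct \<Rightarrow> ('a, 'o, 'm) qcat \<Rightarrow> 'a \<Rightarrow> 'a \<Rightarrow> bool" where
  "under_le Q X x y \<longleftrightarrow>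
    ty X x = ty X y \<and> Idt Q (ty X x) \<sqsubseteq>\<^bsub>Hom Q (ty X x) (ty X y)\<^esub> hm X x y"

definition qfunctor ::
  "('o, 'm) quantaloid_struct \<Rightarrow> ('a, 'o, 'm) qcat \<Rightarrow> ('b, 'o, 'm) qcat \<Rightarrow> ('a \<Rightarrow> 'b) \<Rightarrow> bool" where
  "qfunctor Q X Y f \<longleftrightarrow>
    f \<in> carrier X \<rightarrow>\<^sub>E carrier Y \<and>
    (\<forall>x \<in> carrier X. ty Y (f x) = ty X x) \<and>
    (\<forall>x \<in> carrier X. \<forall>y \<in> carrier X. hm X x y \<sqsubseteq>\<^bsub>Hom Q (ty X x) (ty X y)\<^esub> hm Y (f x) (f y))"

definition qfunctor_le ::
  "('o, 'm) quantaloid_struct \<Rightarrow> ('a, 'o, 'm) qcat \<Rightarrow> ('b, 'o, 'm) qcat \<Rightarrow>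
    ('a \<Rightarrow> 'b) \<Rightarrow> ('a \<Rightarrow> 'b) \<Rightarrow> bool" where
  "qfunctor_le Q X Y f g \<longleftrightarrow> (\<forall>x \<in> carrier X. under_le Q Y (f x) (g x))"

definition distributor ::
  "('o, 'm) quantaloid_struct \<Rightarrow> ('a, 'o, 'm) qcat \<Rightarrow> ('b, 'o, 'm) qcat \<Rightarrow>
    ('a \<Rightarrow> 'b \<Rightarrow> 'm) \<Rightarrow> bool" where
  "distributor Q X Y \<phi> \<longleftrightarrow>
    \<phi> \<in> families Q X Y \<and>
    (\<forall>x \<in> carrier X. \<forall>x' \<in> carrier X. \<forall>y \<in> carrier Y. \<forall>y' \<in> carrier Y.
      Comp Q (ty X x') (ty Y y) (ty Y y') (hm Y y y')
        (Comp Q (ty X x') (ty X x) (ty Y y) (\<phi> x y) (hm X x' x))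
        \<sqsubseteq>\<^bsub>Hom Q (ty X x') (ty Y y')\<^esub> \<phi> x' y')"

definition dist_le ::
  "('o, 'm) quantaloid_struct \<Rightarrow> ('a, 'o, 'm) qcat \<Rightarrow> ('b, 'o, 'm) qcat \<Rightarrow>
    ('a \<Rightarrow> 'b \<Rightarrow> 'm) \<Rightarrow> ('a \<Rightarrow> 'b \<Rightarrow> 'm) \<Rightarrow> bool" where
  "dist_le Q X Y \<phi> \<phi>' \<longleftrightarrow>
    (\<forall>x \<in> carrier X. \<forall>y \<in> carrier Y. \<phi> x y \<sqsubseteq>\<^bsub>Hom Q (ty X x) (ty Y y)\<^esub> \<phi>' x y)"

definition dist_comp ::
  "('o, 'm) quantaloid_struct \<Rightarrow> ('a, 'o, 'm) qcat \<Rightarrow> ('b, 'o, 'm) qcat \<Rightarrow> ('c, 'o, 'm) qcat \<Rightarrow>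
    ('b \<Rightarrow> 'c \<Rightarrow> 'm) \<Rightarrow> ('a \<Rightarrow> 'b \<Rightarrow> 'm) \<Rightarrow> ('a \<Rightarrow> 'c \<Rightarrow> 'm)" where
  "dist_comp Q X Y Z \<psi> \<phi> =
    (\<lambda>x \<in> carrier X. \<lambda>z \<in> carrier Z.
      \<Squnion>\<^bsub>Hom Q (ty X x) (ty Z z)\<^esub>
        ((\<lambda>y. Comp Q (ty X x) (ty Y y) (ty Z z) (\<psi> y z) (\<phi> x y)) ` carrier Y))"

text \<open>For \<open>\<phi>\<close> from \<open>X\<close> to \<open>Y\<close> and \<open>\<xi>\<close> from \<open>X\<close> to \<open>Z\<close>, this is \<open>\<xi> \<swarrow> \<phi>\<close> from \<open>Y\<close> to \<open>Z\<close>.\<close>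

definition dist_residual ::
  "('o, 'm) quantaloid_struct \<Rightarrow> ('a, 'o, 'm) qcat \<Rightarrow> ('b, 'o, 'm) qcat \<Rightarrow> ('c, 'o, 'm) qcat \<Rightarrow>
    ('a \<Rightarrow> 'c \<Rightarrow> 'm) \<Rightarrow> ('a \<Rightarrow> 'b \<Rightarrow> 'm) \<Rightarrow> ('b \<Rightarrow> 'c \<Rightarrow> 'm)" where
  "dist_residual Q X Y Z \<xi> \<phi> =
    (\<lambda>y \<in> carrier Y. \<lambda>z \<in> carrier Z.
      \<Sqinter>\<^bsub>Hom Q (ty Y y) (ty Z z)\<^esub>
        ((\<lambda>x. residual Q (ty X x) (ty Y y) (ty Z z) (\<xi> x z) (\<phi> x y)) ` carrier X))"

text \<open>
  The objects are all \<open>Q\<close>-categories whose underlying set is a subset of the type \<open>'a\<close>,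
  which plays the role of the universe of sets.
\<close>

definition QDist ::
  "('o, 'm) quantaloid_struct \<Rightarrow> (('a, 'o, 'm) qcat, 'a \<Rightarrow> 'a \<Rightarrow> 'm) quantaloid_struct" where
  "QDist Q =
    \<lparr> Ob = {X. qcategory Q X},
      Hom = (\<lambda>X Y. \<lparr> carrier = {\<phi>. distributor Q X Y \<phi>}, eq = (=), le = dist_le Q X Y \<rparr>),
      Comp = dist_comp Q,
      Idt = hm \<rparr>"


section \<open>Presheaves and Kan adjunctions\<close>

definition point :: "('o, 'm) quantaloid_struct \<Rightarrow> 'o \<Rightarrow> (unit, 'o, 'm) qcat" where
  "point Q q = \<lparr> carrier = UNIV, ty = (\<lambda>_. q), hm = (\<lambda>_ _. Idt Q q) \<rparr>"

text \<open>
  A presheaf is paired with its type, which cannot be read off from the underlying family.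
  The distributor \<open>\<mu>' \<swarrow> \<mu>\<close> between one-object \<open>Q\<close>-categories is identified with
  its only component.
\<close>

type_synonym ('a, 'o, 'm) presheaf = "'o \<times> ('a \<Rightarrow> unit \<Rightarrow> 'm)"

definition presheaves ::
  "('o, 'm) quantaloid_struct \<Rightarrow> ('a, 'o, 'm) qcat \<Rightarrow> ('a, 'o, 'm) presheaf set" where
  "presheaves Q X = {(q, \<mu>). q \<in> Ob Q \<and> distributor Q X (point Q q) \<mu>}"

definition PSh ::
  "('o, 'm) quantaloid_struct \<Rightarrow> ('a, 'o, 'm) qcat \<Rightarrow> (('a, 'o, 'm) presheaf, 'o, 'm) qcat" where
  "PSh Q X =
    \<lparr> carrier = presheaves Q X,
      ty = (\<lambda>m \<in> presheaves Q X. fst m),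
      hm = (\<lambda>m \<in> presheaves Q X. \<lambda>m' \<in> presheaves Q X.
        dist_residual Q X (point Q (fst m)) (point Q (fst m')) (snd m') (snd m) () ()) \<rparr>"

text \<open>For \<open>\<phi>\<close> from \<open>X\<close> to \<open>Y\<close>: \<open>\<phi>\<^sup>*\<close> from \<open>PSh Q Y\<close> to \<open>PSh Q X\<close>.\<close>

definition kan_upper ::
  "('o, 'm) quantaloid_struct \<Rightarrow> ('a, 'o, 'm) qcat \<Rightarrow> ('b, 'o, 'm) qcat \<Rightarrow> ('a \<Rightarrow> 'b \<Rightarrow> 'm) \<Rightarrow>
    ('b, 'o, 'm) presheaf \<Rightarrow> ('a, 'o, 'm) presheaf" where
  "kan_upper Q X Y \<phi> =
    (\<lambda>l \<in> carrier (PSh Q Y). (fst l, dist_comp Q X Y (point Q (fst l)) (snd l) \<phi>))"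

text \<open>For \<open>\<phi>\<close> from \<open>X\<close> to \<open>Y\<close>: \<open>\<phi>\<^sub>*\<close> from \<open>PSh Q X\<close> to \<open>PSh Q Y\<close>.\<close>

definition kan_lower ::
  "('o, 'm) quantaloid_struct \<Rightarrow> ('a, 'o, 'm) qcat \<Rightarrow> ('b, 'o, 'm) qcat \<Rightarrow> ('a \<Rightarrow> 'b \<Rightarrow> 'm) \<Rightarrow>
    ('a, 'o, 'm) presheaf \<Rightarrow> ('b, 'o, 'm) presheaf" where
  "kan_lower Q X Y \<phi> =
    (\<lambda>m \<in> carrier (PSh Q X). (fst m, dist_residual Q X Y (point Q (fst m)) (snd m) \<phi>))"


section \<open>Interior spaces\<close>

type_synonym ('a, 'o, 'm) ispace =
  "('a, 'o, 'm) qcat \<times> (('a, 'o, 'm) presheaf \<Rightarrow> ('a, 'o, 'm) presheaf)"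

definition interior_space :: "('o, 'm) quantaloid_struct \<Rightarrow> ('a, 'o, 'm) ispace \<Rightarrow> bool" where
  "interior_space Q = (\<lambda>(X, a).
    qcategory Q X \<and>
    qfunctor Q (PSh Q X) (PSh Q X) a \<and>
    qfunctor_le Q (PSh Q X) (PSh Q X) a (\<lambda>m \<in> carrier (PSh Q X). m) \<and>
    compose (carrier (PSh Q X)) a a = a)"

definition continuous_dist ::
  "('o, 'm) quantaloid_struct \<Rightarrow> ('a, 'o, 'm) ispace \<Rightarrow> ('a, 'o, 'm) ispace \<Rightarrow>
    ('a \<Rightarrow> 'a \<Rightarrow> 'm) \<Rightarrow> bool" where
  "continuous_dist Q = (\<lambda>(X, a) (Y, b) \<zeta>.
    distributor Q X Y \<zeta> \<and>
    qfunctor_le Q (PSh Q Y) (PSh Q X)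
      (compose (carrier (PSh Q Y)) (kan_upper Q X Y \<zeta>) b)
      (compose (carrier (PSh Q Y)) a (kan_upper Q X Y \<zeta>)))"

definition IntDist ::
  "('o, 'm) quantaloid_struct \<Rightarrow> (('a, 'o, 'm) ispace, 'a \<Rightarrow> 'a \<Rightarrow> 'm) quantaloid_struct" where
  "IntDist Q =
    \<lparr> Ob = {S. interior_space Q S},
      Hom = (\<lambda>S T. \<lparr> carrier = {\<zeta>. continuous_dist Q S T \<zeta>},
                     eq = (=), le = dist_le Q (fst S) (fst T) \<rparr>),
      Comp = (\<lambda>S T U. dist_comp Q (fst S) (fst T) (fst U)),
      Idt = (\<lambda>S. hm (fst S)) \<rparr>"


section \<open>The arrow quantaloid and the assignment\<close>

text \<open>An object \<open>(X, Y, \<phi>)\<close> is an arrow \<open>\<phi> : X \<rightarrow> Y\<close> together with its end points.\<close>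

definition Arr ::
  "('o, 'm) quantaloid_struct \<Rightarrow> ('o \<times> 'o \<times> 'm, 'm \<times> 'm) quantaloid_struct" where
  "Arr Q =
    \<lparr> Ob = {(X, Y, \<phi>). X \<in> Ob Q \<and> Y \<in> Ob Q \<and> \<phi> \<in> Arrows Q X Y},
      Hom = (\<lambda>(X, Y, \<phi>) (X', Y', \<psi>).
        \<lparr> carrier = {(\<zeta>, \<eta>). \<zeta> \<in> Arrows Q X X' \<and> \<eta> \<in> Arrows Q Y Y' \<and>
                             Comp Q X X' Y' \<psi> \<zeta> = Comp Q X Y Y' \<eta> \<phi>},
          eq = (=),
          le = (\<lambda>(\<zeta>, \<eta>) (\<zeta>', \<eta>'). \<zeta> \<sqsubseteq>\<^bsub>Hom Q X X'\<^esub> \<zeta>' \<and> \<eta> \<sqsubseteq>\<^bsub>Hom Q Y Y'\<^esub> \<eta>') \<rparr>),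
      Comp = (\<lambda>(X, Y, \<phi>) (X', Y', \<phi>') (X'', Y'', \<phi>'') (\<zeta>', \<eta>') (\<zeta>, \<eta>).
        (Comp Q X X' X'' \<zeta>' \<zeta>, Comp Q Y Y' Y'' \<eta>' \<eta>)),
      Idt = (\<lambda>(X, Y, \<phi>). (Idt Q X, Idt Q Y)) \<rparr>"

definition Khat_ob ::
  "('o, 'm) quantaloid_struct \<Rightarrow>
    ('a, 'o, 'm) qcat \<times> ('a, 'o, 'm) qcat \<times> ('a \<Rightarrow> 'a \<Rightarrow> 'm) \<Rightarrow> ('a, 'o, 'm) ispace" where
  "Khat_ob Q = (\<lambda>(X, Y, \<phi>).
    (X, compose (carrier (PSh Q X)) (kan_upper Q X Y \<phi>) (kan_lower Q X Y \<phi>)))"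

definition Khat_arr ::
  "('a, 'o, 'm) qcat \<times> ('a, 'o, 'm) qcat \<times> ('a \<Rightarrow> 'a \<Rightarrow> 'm) \<Rightarrow>
   ('a, 'o, 'm) qcat \<times> ('a, 'o, 'm) qcat \<times> ('a \<Rightarrow> 'a \<Rightarrow> 'm) \<Rightarrow>
    ('a \<Rightarrow> 'a \<Rightarrow> 'm) \<times> ('a \<Rightarrow> 'a \<Rightarrow> 'm) \<Rightarrow> ('a \<Rightarrow> 'a \<Rightarrow> 'm)" where
  "Khat_arr = (\<lambda>\<phi> \<psi> (\<zeta>, \<eta>). \<zeta>)"

end

theory Submission
  imports Defs
begin

text \<open>
  Families of arrows indexed by pairs of elements compose, have residuals and suprema just as
  arrows of \<open>Q\<close> do, whether or not they are distributors, and every statement about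
  presheaves and Kan adjunctions is a statement about such families. For a commuting square
  \<open>\<psi> \<circ> \<zeta> = \<eta> \<circ> \<phi>\<close> and a presheaf \<open>\<lambda>\<close>, one has
  \<open>(\<lambda> \<swarrow> \<psi>) \<circ> \<eta> \<circ> \<phi> = (\<lambda> \<swarrow> \<psi>) \<circ> \<psi> \<circ> \<zeta> \<le> \<lambda> \<circ> \<zeta>\<close>, hence
  \<open>(\<lambda> \<swarrow> \<psi>) \<circ> \<eta> \<le> (\<lambda> \<circ> \<zeta>) \<swarrow> \<phi>\<close>, and composing with \<open>\<phi>\<close> gives
  the continuity of \<open>\<zeta>\<close>. Conversely, a continuous \<open>\<zeta>\<close> is completed to a square by
  \<open>\<eta> = (\<psi> \<circ> \<zeta>) \<swarrow> \<phi>\<close>.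
\<close>


section \<open>Complete lattices by their suprema\<close>

text \<open>The interior operator of \<open>\<phi>\<close> sends \<open>\<mu>\<close> to
  \<open>(\<mu> \<swarrow> \<phi>) \<circ> \<phi>\<close>, the largest presheaf below
  \<open>\<mu>\<close> that factors through \<open>\<phi>\<close>. Its fixed points are the
  presheaves factoring through \<open>\<phi>\<close>, so continuity of \<open>\<zeta>\<close>
  amounts to this: if \<open>\<lambda>\<close> factors through \<open>\<psi>\<close>, then
  \<open>\<lambda> \<circ> \<zeta>\<close> factors through \<open>\<phi>\<close>. Every column of
  \<open>\<psi>\<close> factors through \<open>\<psi>\<close>, hence every column of
  \<open>\<psi> \<circ> \<zeta>\<close> factors through \<open>\<phi>\<close>; since composites and
  residuals are computed column by column, these factorizations fit together into one
  \<open>\<eta>\<close>. An obstacle is the typing of presheaves: they end at a one-object category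
  over \<open>unit\<close>, while all objects of \<open>QDist Q\<close> lie over a single type. A
  presheaf is thus not an arrow of \<open>QDist Q\<close>, and the calculus has to be available for
  families between categories over different types.\<close>

lemma complete_lattice_supI:
  fixes L :: "'a gorder"
  assumes eq: "(.=\<^bsub>L\<^esub>) = (=)"
    and refl: "\<And>x. x \<in> carrier L \<Longrightarrow> x \<sqsubseteq>\<^bsub>L\<^esub> x"
    and antisym: "\<And>x y. \<lbrakk>x \<in> carrier L; y \<in> carrier L; x \<sqsubseteq>\<^bsub>L\<^esub> y; y \<sqsubseteq>\<^bsub>L\<^esub> x\<rbrakk> \<Longrightarrow> x = y"
    and trans: "\<And>x y z. \<lbrakk>x \<in> carrier L; y \<in> carrier L; z \<in> carrier L; x \<sqsubseteq>\<^bsub>L\<^esub> y; y \<sqsubseteq>\<^bsub>L\<^esub> z\<rbrakk> \<Longrightarrow> x \<sqsubseteq>\<^bsub>L\<^esub> z"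
    and sup: "\<And>A. A \<subseteq> carrier L \<Longrightarrow>
      \<exists>s\<in>carrier L. \<forall>w\<in>carrier L. s \<sqsubseteq>\<^bsub>L\<^esub> w \<longleftrightarrow> (\<forall>a\<in>A. a \<sqsubseteq>\<^bsub>L\<^esub> w)"
  shows "complete_lattice L"
proof -
  interpret partial_order L
  proof (unfold_locales, unfold eq)
    fix x y z assume "x \<in> carrier L" "y \<in> carrier L" "z \<in> carrier L"
    then show "x \<sqsubseteq>\<^bsub>L\<^esub> y \<Longrightarrow> y \<sqsubseteq>\<^bsub>L\<^esub> z \<Longrightarrow> x \<sqsubseteq>\<^bsub>L\<^esub> z"
      by (rule trans)
  qed (simp_all add: refl antisym)
  show ?thesis
  proof
    fix A assume A: "A \<subseteq> carrier L"
    then obtain s where "s \<in> carrier L" "\<forall>w\<in>carrier L. s \<sqsubseteq>\<^bsub>L\<^esub> w \<longleftrightarrow> (\<forall>a\<in>A. a \<sqsubseteq>\<^bsub>L\<^esub> w)"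
      using sup by blast
    with A have "least L s (Upper L A)"
      by (intro least_UpperI) (auto simp: Upper_def)
    then show "\<exists>s. least L s (Upper L A)" ..
    \<comment> \<open>An infimum of \<open>A\<close> is obtained as the supremum of its lower
      bounds.\<close>
    have "Lower L A \<subseteq> carrier L" by simp
    then obtain i where i: "i \<in> carrier L"
      "\<forall>w\<in>carrier L. i \<sqsubseteq>\<^bsub>L\<^esub> w \<longleftrightarrow> (\<forall>a\<in>Lower L A. a \<sqsubseteq>\<^bsub>L\<^esub> w)"
      using sup by meson
    then have "greatest L i (Lower L A)"
      using A by (intro greatest_LowerI) (auto simp: Lower_def)
    then show "\<exists>i. greatest L i (Lower L A)" ..
  qed
qed

lemma (in complete_lattice) sup_le_iff:
  assumes "A \<subseteq> carrier L" "w \<in> carrier L"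
  shows "\<Squnion>A \<sqsubseteq> w \<longleftrightarrow> (\<forall>a\<in>A. a \<sqsubseteq> w)"
  using assms by (meson le_trans subsetD sup_closed sup_least sup_upper)

lemma (in complete_lattice) le_inf_iff:
  assumes "A \<subseteq> carrier L" "w \<in> carrier L"
  shows "w \<sqsubseteq> \<Sqinter>A \<longleftrightarrow> (\<forall>a\<in>A. w \<sqsubseteq> a)"
  using assms by (meson le_trans subsetD inf_closed inf_greatest inf_lower)

text \<open>The case \<open>w = s\<close> of the equivalence already makes \<open>s\<close> an upper
  bound, and the case \<open>w = \<Squnion>A\<close> makes it the least one.\<close>

lemma (in complete_lattice) sup_eqI:
  assumes "A \<subseteq> carrier L" "s \<in> carrier L"
    "\<And>w. w \<in> carrier L \<Longrightarrow> s \<sqsubseteq> w \<longleftrightarrow> (\<forall>a\<in>A. a \<sqsubseteq> w)"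
  shows "\<Squnion>A = s"
proof (rule le_antisym)
  show "\<Squnion>A \<sqsubseteq> s" using assms by (simp add: sup_le_iff) (metis le_refl)
  show "s \<sqsubseteq> \<Squnion>A" using assms by (simp add: sup_upper)
qed (use assms in auto)


section \<open>Residuals in a quantaloid\<close>

context quantaloid
begin

lemma arrow_refl: "\<lbrakk>p \<in> Ob Q; q \<in> Ob Q; u \<in> Arrows Q p q\<rbrakk> \<Longrightarrow> u \<sqsubseteq>\<^bsub>Hom Q p q\<^esub> u"
  by (meson complete_lattice.axioms(1) hom_complete_lattice partial_order.axioms(1) weak_partial_order.le_refl)

lemma arrow_trans:
  assumes "p \<in> Ob Q" "q \<in> Ob Q" "u \<in> Arrows Q p q" "v \<in> Arrows Q p q" "w \<in> Arrows Q p q"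
    "u \<sqsubseteq>\<^bsub>Hom Q p q\<^esub> v" "v \<sqsubseteq>\<^bsub>Hom Q p q\<^esub> w"
  shows "u \<sqsubseteq>\<^bsub>Hom Q p q\<^esub> w"
proof -
  interpret complete_lattice "Hom Q p q" using assms by (intro hom_complete_lattice)
  show ?thesis using assms(3-) by (meson le_trans)
qed

lemma arrow_antisym:
  assumes "p \<in> Ob Q" "q \<in> Ob Q" "u \<in> Arrows Q p q" "v \<in> Arrows Q p q"
    "u \<sqsubseteq>\<^bsub>Hom Q p q\<^esub> v" "v \<sqsubseteq>\<^bsub>Hom Q p q\<^esub> u"
  shows "u = v"
proof -
  interpret complete_lattice "Hom Q p q" using assms by (intro hom_complete_lattice)
  show ?thesis using assms(3-) by (meson le_antisym)
qed

lemma sup_closed: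
  "\<lbrakk>p \<in> Ob Q; q \<in> Ob Q; A \<subseteq> Arrows Q p q\<rbrakk> \<Longrightarrow> \<Squnion>\<^bsub>Hom Q p q\<^esub> A \<in> Arrows Q p q"
proof -
  assume *: "p \<in> Ob Q" "q \<in> Ob Q" "A \<subseteq> Arrows Q p q"
  then interpret complete_lattice "Hom Q p q" by (intro hom_complete_lattice)
  show ?thesis using * by (intro sup_closed)
qed

lemma inf_closed:
  "\<lbrakk>p \<in> Ob Q; q \<in> Ob Q; A \<subseteq> Arrows Q p q\<rbrakk> \<Longrightarrow> \<Sqinter>\<^bsub>Hom Q p q\<^esub> A \<in> Arrows Q p q"
proof -
  assume *: "p \<in> Ob Q" "q \<in> Ob Q" "A \<subseteq> Arrows Q p q"
  then interpret complete_lattice "Hom Q p q" by (intro hom_complete_lattice)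
  show ?thesis using * by (intro inf_closed)
qed

lemmas sup_le_iff = complete_lattice.sup_le_iff[OF hom_complete_lattice]
  and le_inf_iff = complete_lattice.le_inf_iff[OF hom_complete_lattice]
  and sup_eqI = complete_lattice.sup_eqI[OF hom_complete_lattice]

text \<open>Join preservation and the universal property of suprema in one step: a supremum inside a
  composite dissolves once the composite is compared with an upper bound. Estimates of composites of
  families reduce to elementary ones by this and its mirror image.\<close>

lemma comp_sup_left_le_iff:
  assumes "p \<in> Ob Q" "q \<in> Ob Q" "r \<in> Ob Q" "u \<in> Arrows Q p q" "B \<subseteq> Arrows Q q r"
    "w \<in> Arrows Q p r"
  shows "Comp Q p q r (\<Squnion>\<^bsub>Hom Q q r\<^esub> B) u \<sqsubseteq>\<^bsub>Hom Q p r\<^esub> w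
    \<longleftrightarrow> (\<forall>v\<in>B. Comp Q p q r v u \<sqsubseteq>\<^bsub>Hom Q p r\<^esub> w)"
proof -
  have "(\<lambda>v. Comp Q p q r v u) ` B \<subseteq> Arrows Q p r"
    using assms comp_closed by blast
  with assms show ?thesis
    by (simp add: comp_join_left sup_le_iff)
qed

lemma comp_sup_right_le_iff:
  assumes "p \<in> Ob Q" "q \<in> Ob Q" "r \<in> Ob Q" "A \<subseteq> Arrows Q p q" "v \<in> Arrows Q q r"
    "w \<in> Arrows Q p r"
  shows "Comp Q p q r v (\<Squnion>\<^bsub>Hom Q p q\<^esub> A) \<sqsubseteq>\<^bsub>Hom Q p r\<^esub> w
    \<longleftrightarrow> (\<forall>u\<in>A. Comp Q p q r v u \<sqsubseteq>\<^bsub>Hom Q p r\<^esub> w)"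
proof -
  have "(\<lambda>u. Comp Q p q r v u) ` A \<subseteq> Arrows Q p r"
    using assms comp_closed by blast
  with assms show ?thesis
    by (simp add: comp_join_right sup_le_iff)
qed

lemma sup_pair:
  assumes "p \<in> Ob Q" "q \<in> Ob Q" "u \<in> Arrows Q p q" "u' \<in> Arrows Q p q" "u \<sqsubseteq>\<^bsub>Hom Q p q\<^esub> u'"
  shows "\<Squnion>\<^bsub>Hom Q p q\<^esub> {u, u'} = u'"
  using assms by (intro sup_eqI) (auto intro: arrow_trans[of p q u u'])

text \<open>The quantaloid axioms speak of joins rather than of the order, so
  \<open>u \<sqsubseteq> u'\<close> is read as the statement that \<open>{u, u'}\<close> has join
  \<open>u'\<close>. The two arguments are enlarged one at a time.\<close>

lemma comp_mono:
  assumes "p \<in> Ob Q" "q \<in> Ob Q" "r \<in> Ob Q" "u \<in> Arrows Q p q" "u' \<in> Arrows Q p q"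
    "v \<in> Arrows Q q r" "v' \<in> Arrows Q q r" "u \<sqsubseteq>\<^bsub>Hom Q p q\<^esub> u'" "v \<sqsubseteq>\<^bsub>Hom Q q r\<^esub> v'"
  shows "Comp Q p q r v u \<sqsubseteq>\<^bsub>Hom Q p r\<^esub> Comp Q p q r v' u'"
proof -
  have "Comp Q p q r v u \<sqsubseteq>\<^bsub>Hom Q p r\<^esub> Comp Q p q r v u'"
    using comp_sup_right_le_iff[of p q r "{u, u'}" v "Comp Q p q r v u'"] assms
    by (simp add: sup_pair comp_closed arrow_refl)
  moreover have "Comp Q p q r v u' \<sqsubseteq>\<^bsub>Hom Q p r\<^esub> Comp Q p q r v' u'"
    using comp_sup_left_le_iff[of p q r u' "{v, v'}" "Comp Q p q r v' u'"] assms
    by (simp add: sup_pair comp_closed arrow_refl)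
  ultimately show ?thesis
    using assms by (meson arrow_trans comp_closed)
qed

text \<open>The adjoint functor theorem for the join-preserving map
  \<open>v \<mapsto> v \<circ> u\<close>: the join of all solutions \<open>v\<close> of
  \<open>v \<circ> u \<le> w\<close> is again a solution. Uniqueness makes the definite description
  in \<open>residual\<close> denote this arrow.\<close>

lemma residual_exists:
  assumes "p \<in> Ob Q" "q \<in> Ob Q" "r \<in> Ob Q" "u \<in> Arrows Q p q" "w \<in> Arrows Q p r"
  shows "\<exists>!t. t \<in> Arrows Q q r \<and>
      (\<forall>v \<in> Arrows Q q r. Comp Q p q r v u \<sqsubseteq>\<^bsub>Hom Q p r\<^esub> w \<longleftrightarrow> v \<sqsubseteq>\<^bsub>Hom Q q r\<^esub> t)"
proof (rule ex_ex1I)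
  let ?B = "{v \<in> Arrows Q q r. Comp Q p q r v u \<sqsubseteq>\<^bsub>Hom Q p r\<^esub> w}"
  let ?t = "\<Squnion>\<^bsub>Hom Q q r\<^esub> ?B"
  have t: "?t \<in> Arrows Q q r" using assms by (intro sup_closed) auto
  have tw: "Comp Q p q r ?t u \<sqsubseteq>\<^bsub>Hom Q p r\<^esub> w"
    using assms by (subst comp_sup_left_le_iff) auto
  have "Comp Q p q r v u \<sqsubseteq>\<^bsub>Hom Q p r\<^esub> w \<longleftrightarrow> v \<sqsubseteq>\<^bsub>Hom Q q r\<^esub> ?t" if v: "v \<in> Arrows Q q r" for v
  proof
    assume "Comp Q p q r v u \<sqsubseteq>\<^bsub>Hom Q p r\<^esub> w"
    moreover have "?t \<sqsubseteq>\<^bsub>Hom Q q r\<^esub> ?t" using assms t by (intro arrow_refl)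
    ultimately show "v \<sqsubseteq>\<^bsub>Hom Q q r\<^esub> ?t"
      using v assms t sup_le_iff[of q r ?B ?t] by auto
  next
    assume "v \<sqsubseteq>\<^bsub>Hom Q q r\<^esub> ?t"
    then have "Comp Q p q r v u \<sqsubseteq>\<^bsub>Hom Q p r\<^esub> Comp Q p q r ?t u"
      using v t assms by (intro comp_mono) (auto intro: arrow_refl)
    then show "Comp Q p q r v u \<sqsubseteq>\<^bsub>Hom Q p r\<^esub> w"
      using tw v t assms by (meson arrow_trans comp_closed)
  qed
  with t show "\<exists>t. t \<in> Arrows Q q r \<and>
      (\<forall>v \<in> Arrows Q q r. Comp Q p q r v u \<sqsubseteq>\<^bsub>Hom Q p r\<^esub> w \<longleftrightarrow> v \<sqsubseteq>\<^bsub>Hom Q q r\<^esub> t)"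
    by blast
next
  fix t t'
  assume "t \<in> Arrows Q q r \<and>
      (\<forall>v \<in> Arrows Q q r. Comp Q p q r v u \<sqsubseteq>\<^bsub>Hom Q p r\<^esub> w \<longleftrightarrow> v \<sqsubseteq>\<^bsub>Hom Q q r\<^esub> t)"
    and "t' \<in> Arrows Q q r \<and>
      (\<forall>v \<in> Arrows Q q r. Comp Q p q r v u \<sqsubseteq>\<^bsub>Hom Q p r\<^esub> w \<longleftrightarrow> v \<sqsubseteq>\<^bsub>Hom Q q r\<^esub> t')"
  then show "t = t'"
    using assms by (intro arrow_antisym[of q r]) (auto simp: arrow_refl)
qed

lemma residual_closed:
  assumes "p \<in> Ob Q" "q \<in> Ob Q" "r \<in> Ob Q" "u \<in> Arrows Q p q" "w \<in> Arrows Q p r"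
  shows "residual Q p q r w u \<in> Arrows Q q r"
  unfolding residual_def using theI'[OF residual_exists[OF assms]] by blast

lemma le_residual_iff:
  assumes "p \<in> Ob Q" "q \<in> Ob Q" "r \<in> Ob Q" "u \<in> Arrows Q p q" "w \<in> Arrows Q p r"
    "v \<in> Arrows Q q r"
  shows "v \<sqsubseteq>\<^bsub>Hom Q q r\<^esub> residual Q p q r w u \<longleftrightarrow> Comp Q p q r v u \<sqsubseteq>\<^bsub>Hom Q p r\<^esub> w"
  unfolding residual_def using theI'[OF residual_exists[OF assms(1-5)]] assms(6) by blast


section \<open>The calculus of families of arrows\<close>

lemma qcategory_ty: "qcategory Q X \<Longrightarrow> x \<in> carrier X \<Longrightarrow> ty X x \<in> Ob Q"
  unfolding qcategory_def by auto

lemma families_arrow: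
  "\<lbrakk>\<phi> \<in> families Q X Y; x \<in> carrier X; y \<in> carrier Y\<rbrakk> \<Longrightarrow> \<phi> x y \<in> Arrows Q (ty X x) (ty Y y)"
  unfolding families_def by (auto simp: PiE_iff)

lemma restrict_families:
  assumes "\<And>x y. \<lbrakk>x \<in> carrier X; y \<in> carrier Y\<rbrakk> \<Longrightarrow> f x y \<in> Arrows Q (ty X x) (ty Y y)"
  shows "(\<lambda>x \<in> carrier X. \<lambda>y \<in> carrier Y. f x y) \<in> families Q X Y"
  unfolding families_def using assms by (auto simp: PiE_iff)

lemma families_eqI:
  assumes "\<phi> \<in> families Q X Y" "\<psi> \<in> families Q X Y"
    "\<And>x y. \<lbrakk>x \<in> carrier X; y \<in> carrier Y\<rbrakk> \<Longrightarrow> \<phi> x y = \<psi> x y"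
  shows "\<phi> = \<psi>"
proof (rule PiE_ext[OF assms(1,2)[unfolded families_def]])
  fix x assume x: "x \<in> carrier X"
  with assms(1,2) have "\<phi> x \<in> (\<Pi>\<^sub>E y \<in> carrier Y. Arrows Q (ty X x) (ty Y y))"
    "\<psi> x \<in> (\<Pi>\<^sub>E y \<in> carrier Y. Arrows Q (ty X x) (ty Y y))"
    unfolding families_def by (auto dest: PiE_mem)
  then show "\<phi> x = \<psi> x"
    by (rule PiE_ext) (use assms(3) x in auto)
qed

lemma dist_le_refl:
  "\<lbrakk>qcategory Q X; qcategory Q Y; \<phi> \<in> families Q X Y\<rbrakk> \<Longrightarrow> dist_le Q X Y \<phi> \<phi>"
  unfolding dist_le_def by (auto intro: arrow_refl qcategory_ty families_arrow)

lemma dist_le_trans: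
  assumes "qcategory Q X" "qcategory Q Y"
    "\<phi> \<in> families Q X Y" "\<psi> \<in> families Q X Y" "\<xi> \<in> families Q X Y"
    "dist_le Q X Y \<phi> \<psi>" "dist_le Q X Y \<psi> \<xi>"
  shows "dist_le Q X Y \<phi> \<xi>"
  using assms unfolding dist_le_def by (meson arrow_trans qcategory_ty families_arrow)

lemma dist_le_antisym:
  assumes "qcategory Q X" "qcategory Q Y" "\<phi> \<in> families Q X Y" "\<psi> \<in> families Q X Y"
    "dist_le Q X Y \<phi> \<psi>" "dist_le Q X Y \<psi> \<phi>"
  shows "\<phi> = \<psi>"
proof (rule families_eqI[OF assms(3,4)])
  fix x y assume "x \<in> carrier X" "y \<in> carrier Y"
  with assms show "\<phi> x y = \<psi> x y"
    by (intro arrow_antisym[of "ty X x" "ty Y y"])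
      (auto simp: dist_le_def intro: qcategory_ty families_arrow)
qed

text \<open>A Yoneda argument: families with the same upper bounds coincide. It suits equations
  between composites, because the supremum in a composite disappears when the composite is bounded
  above.\<close>

lemma dist_le_eqI:
  assumes "qcategory Q X" "qcategory Q Y" "\<phi> \<in> families Q X Y" "\<psi> \<in> families Q X Y"
    "\<And>\<xi>. \<xi> \<in> families Q X Y \<Longrightarrow> dist_le Q X Y \<phi> \<xi> \<longleftrightarrow> dist_le Q X Y \<psi> \<xi>"
  shows "\<phi> = \<psi>"
  by (rule dist_le_antisym[OF assms(1-4)]) (use assms dist_le_refl in auto)

lemma dist_comp_arrows:
  assumes "qcategory Q X" "qcategory Q Y" "qcategory Q Z" "\<phi> \<in> families Q X Y"
    "\<psi> \<in> families Q Y Z" "x \<in> carrier X" "z \<in> carrier Z"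
  shows "(\<lambda>y. Comp Q (ty X x) (ty Y y) (ty Z z) (\<psi> y z) (\<phi> x y)) ` carrier Y
    \<subseteq> Arrows Q (ty X x) (ty Z z)"
  using assms by (auto intro!: comp_closed intro: qcategory_ty families_arrow)

lemma dist_comp_families:
  assumes "qcategory Q X" "qcategory Q Y" "qcategory Q Z" "\<phi> \<in> families Q X Y"
    "\<psi> \<in> families Q Y Z"
  shows "dist_comp Q X Y Z \<psi> \<phi> \<in> families Q X Z"
  unfolding dist_comp_def using assms
  by (intro restrict_families sup_closed dist_comp_arrows) (auto intro: qcategory_ty)

text \<open>The join over the middle index turns into a universal quantifier, so that afterwards
  only arrows of \<open>Q\<close> are compared.\<close>

lemma dist_comp_le_iff:
  assumes "qcategory Q X" "qcategory Q Y" "qcategory Q Z" "\<phi> \<in> families Q X Y"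
    "\<psi> \<in> families Q Y Z" "\<xi> \<in> families Q X Z"
  shows "dist_le Q X Z (dist_comp Q X Y Z \<psi> \<phi>) \<xi> \<longleftrightarrow>
    (\<forall>x \<in> carrier X. \<forall>y \<in> carrier Y. \<forall>z \<in> carrier Z.
      Comp Q (ty X x) (ty Y y) (ty Z z) (\<psi> y z) (\<phi> x y) \<sqsubseteq>\<^bsub>Hom Q (ty X x) (ty Z z)\<^esub> \<xi> x z)"
proof -
  have "dist_comp Q X Y Z \<psi> \<phi> x z \<sqsubseteq>\<^bsub>Hom Q (ty X x) (ty Z z)\<^esub> \<xi> x z \<longleftrightarrow>
      (\<forall>y \<in> carrier Y.
        Comp Q (ty X x) (ty Y y) (ty Z z) (\<psi> y z) (\<phi> x y) \<sqsubseteq>\<^bsub>Hom Q (ty X x) (ty Z z)\<^esub> \<xi> x z)"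
    if "x \<in> carrier X" "z \<in> carrier Z" for x z
    using that assms dist_comp_arrows[OF assms(1-5) that] 
    by (simp add: dist_comp_def sup_le_iff qcategory_ty families_arrow)
  then show ?thesis unfolding dist_le_def by blast
qed

lemma dist_comp_mono:
  assumes "qcategory Q X" "qcategory Q Y" "qcategory Q Z"
    "\<phi> \<in> families Q X Y" "\<phi>' \<in> families Q X Y" "\<psi> \<in> families Q Y Z" "\<psi>' \<in> families Q Y Z"
    "dist_le Q X Y \<phi> \<phi>'" "dist_le Q Y Z \<psi> \<psi>'"
  shows "dist_le Q X Z (dist_comp Q X Y Z \<psi> \<phi>) (dist_comp Q X Y Z \<psi>' \<phi>')"
proof -
  note ty = assms(1-3)[THEN qcategory_ty] and fam = assms(4-7)[THEN families_arrow]
  have "Comp Q (ty X x) (ty Y y) (ty Z z) (\<psi> y z) (\<phi> x y)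
      \<sqsubseteq>\<^bsub>Hom Q (ty X x) (ty Z z)\<^esub> dist_comp Q X Y Z \<psi>' \<phi>' x z"
    if "x \<in> carrier X" "y \<in> carrier Y" "z \<in> carrier Z" for x y z
  proof (rule arrow_trans)
    show "Comp Q (ty X x) (ty Y y) (ty Z z) (\<psi> y z) (\<phi> x y) \<sqsubseteq>\<^bsub>Hom Q (ty X x) (ty Z z)\<^esub>
        Comp Q (ty X x) (ty Y y) (ty Z z) (\<psi>' y z) (\<phi>' x y)"
      using assms that by (intro comp_mono) (auto simp: dist_le_def ty fam)
    have "dist_le Q X Z (dist_comp Q X Y Z \<psi>' \<phi>') (dist_comp Q X Y Z \<psi>' \<phi>')"
      using assms by (intro dist_le_refl dist_comp_families)
    then show "Comp Q (ty X x) (ty Y y) (ty Z z) (\<psi>' y z) (\<phi>' x y)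
        \<sqsubseteq>\<^bsub>Hom Q (ty X x) (ty Z z)\<^esub> dist_comp Q X Y Z \<psi>' \<phi>' x z"
      using that assms dist_comp_le_iff dist_comp_families by blast
  qed (use that assms in \<open>auto intro!: comp_closed families_arrow[OF dist_comp_families] simp: ty fam\<close>)
  then show ?thesis
    using assms by (auto simp: dist_comp_le_iff dist_comp_families)
qed

lemma dist_comp_assoc:
  assumes "qcategory Q W" "qcategory Q X" "qcategory Q Y" "qcategory Q Z"
    "\<phi> \<in> families Q W X" "\<psi> \<in> families Q X Y" "\<chi> \<in> families Q Y Z"
  shows "dist_comp Q W Y Z \<chi> (dist_comp Q W X Y \<psi> \<phi>) = dist_comp Q W X Z (dist_comp Q X Y Z \<chi> \<psi>) \<phi>"
proof (rule dist_le_eqI)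
  note ty = assms(1-4)[THEN qcategory_ty] and fam = assms(5-7)[THEN families_arrow]
  fix \<xi> assume \<xi>: "\<xi> \<in> families Q W Z"
  \<comment> \<open>The inner supremum is pulled out of the composite, here on the right and in
    \<open>2\<close> on the left. Both bracketings then have the same upper bounds, namely the
    bounds of all threefold composites of entries.\<close>
  have 1: "Comp Q (ty W w) (ty Y y) (ty Z z) (\<chi> y z) (dist_comp Q W X Y \<psi> \<phi> w y)
      \<sqsubseteq>\<^bsub>Hom Q (ty W w) (ty Z z)\<^esub> \<xi> w z \<longleftrightarrow>
      (\<forall>x \<in> carrier X. Comp Q (ty W w) (ty Y y) (ty Z z) (\<chi> y z)
        (Comp Q (ty W w) (ty X x) (ty Y y) (\<psi> x y) (\<phi> w x)) \<sqsubseteq>\<^bsub>Hom Q (ty W w) (ty Z z)\<^esub> \<xi> w z)"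
    if "w \<in> carrier W" "y \<in> carrier Y" "z \<in> carrier Z" for w y z
    using that dist_comp_arrows[of W X Y \<phi> \<psi> w y] assms \<xi>
    by (simp add: dist_comp_def comp_sup_right_le_iff ty fam families_arrow)
  have 2: "Comp Q (ty W w) (ty X x) (ty Z z) (dist_comp Q X Y Z \<chi> \<psi> x z) (\<phi> w x)
      \<sqsubseteq>\<^bsub>Hom Q (ty W w) (ty Z z)\<^esub> \<xi> w z \<longleftrightarrow>
      (\<forall>y \<in> carrier Y. Comp Q (ty W w) (ty Y y) (ty Z z) (\<chi> y z)
        (Comp Q (ty W w) (ty X x) (ty Y y) (\<psi> x y) (\<phi> w x)) \<sqsubseteq>\<^bsub>Hom Q (ty W w) (ty Z z)\<^esub> \<xi> w z)"
    if "w \<in> carrier W" "x \<in> carrier X" "z \<in> carrier Z" for w x z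
    using that dist_comp_arrows[of X Y Z \<psi> \<chi> x z] assms \<xi>
    by (simp add: dist_comp_def comp_sup_left_le_iff ty fam families_arrow comp_assoc)
  show "dist_le Q W Z (dist_comp Q W Y Z \<chi> (dist_comp Q W X Y \<psi> \<phi>)) \<xi> \<longleftrightarrow>
    dist_le Q W Z (dist_comp Q W X Z (dist_comp Q X Y Z \<chi> \<psi>) \<phi>) \<xi>"
    using assms \<xi> by (subst (1 2) dist_comp_le_iff) (auto simp: 1 2 dist_comp_families)
qed (use assms in \<open>auto intro!: dist_comp_families\<close>)

lemma dist_residual_arrows:
  assumes "qcategory Q X" "qcategory Q Y" "qcategory Q Z" "\<phi> \<in> families Q X Y"
    "\<xi> \<in> families Q X Z" "y \<in> carrier Y" "z \<in> carrier Z"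
  shows "(\<lambda>x. residual Q (ty X x) (ty Y y) (ty Z z) (\<xi> x z) (\<phi> x y)) ` carrier X
    \<subseteq> Arrows Q (ty Y y) (ty Z z)"
  using assms by (auto intro!: residual_closed intro: qcategory_ty families_arrow)

lemma dist_residual_families:
  assumes "qcategory Q X" "qcategory Q Y" "qcategory Q Z" "\<phi> \<in> families Q X Y"
    "\<xi> \<in> families Q X Z"
  shows "dist_residual Q X Y Z \<xi> \<phi> \<in> families Q Y Z"
  unfolding dist_residual_def using assms
  by (intro restrict_families inf_closed dist_residual_arrows) (auto intro: qcategory_ty)

text \<open>The infimum in the residual and the supremum in the composite both become universal
  quantifiers, and what remains is the residuation law of \<open>Q\<close> at each triple of
  indices. As it is available for families, it applies to composites before they are known to be
  distributors.\<close>

lemma le_dist_residual_iff: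
  assumes "qcategory Q X" "qcategory Q Y" "qcategory Q Z" "\<phi> \<in> families Q X Y"
    "\<xi> \<in> families Q X Z" "\<psi> \<in> families Q Y Z"
  shows "dist_le Q Y Z \<psi> (dist_residual Q X Y Z \<xi> \<phi>) \<longleftrightarrow>
    dist_le Q X Z (dist_comp Q X Y Z \<psi> \<phi>) \<xi>"
proof -
  have "\<psi> y z \<sqsubseteq>\<^bsub>Hom Q (ty Y y) (ty Z z)\<^esub> dist_residual Q X Y Z \<xi> \<phi> y z \<longleftrightarrow>
      (\<forall>x \<in> carrier X.
        Comp Q (ty X x) (ty Y y) (ty Z z) (\<psi> y z) (\<phi> x y) \<sqsubseteq>\<^bsub>Hom Q (ty X x) (ty Z z)\<^esub> \<xi> x z)"
    if "y \<in> carrier Y" "z \<in> carrier Z" for y z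
    using that assms dist_residual_arrows[OF assms(1-5) that] 
    by (simp add: dist_residual_def le_inf_iff le_residual_iff qcategory_ty families_arrow)
  then show ?thesis unfolding dist_comp_le_iff[OF assms(1-4,6,5)] unfolding dist_le_def by blast
qed

lemma dist_residual_comp_le:
  assumes "qcategory Q X" "qcategory Q Y" "qcategory Q Z" "\<phi> \<in> families Q X Y"
    "\<xi> \<in> families Q X Z"
  shows "dist_le Q X Z (dist_comp Q X Y Z (dist_residual Q X Y Z \<xi> \<phi>) \<phi>) \<xi>"
  using assms le_dist_residual_iff dist_residual_families dist_le_refl by blast


section \<open>The quantaloid of distributors\<close>

lemma hm_families: "qcategory Q X \<Longrightarrow> hm X \<in> families Q X X"
  unfolding qcategory_def by blast

lemma idt_le_hm:
  "\<lbrakk>qcategory Q X; x \<in> carrier X\<rbrakk> \<Longrightarrow> Idt Q (ty X x) \<sqsubseteq>\<^bsub>Hom Q (ty X x) (ty X x)\<^esub> hm X x x"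
  unfolding qcategory_def by blast

lemma distributor_families: "distributor Q X Y \<phi> \<Longrightarrow> \<phi> \<in> families Q X Y"
  unfolding distributor_def by blast

lemma comp_le_dist_comp:
  assumes "qcategory Q X" "qcategory Q Y" "qcategory Q Z" "\<phi> \<in> families Q X Y"
    "\<psi> \<in> families Q Y Z" "x \<in> carrier X" "y \<in> carrier Y" "z \<in> carrier Z"
  shows "Comp Q (ty X x) (ty Y y) (ty Z z) (\<psi> y z) (\<phi> x y)
    \<sqsubseteq>\<^bsub>Hom Q (ty X x) (ty Z z)\<^esub> dist_comp Q X Y Z \<psi> \<phi> x z"
proof -
  note comp = dist_comp_families[OF assms(1-5)]
  show ?thesis
    using dist_comp_le_iff[OF assms(1-5) comp, THEN iffD1, OF dist_le_refl[OF assms(1,3) comp]]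
      assms(6-8) by simp
qed

text \<open>By reflexivity of the hom-arrows, the summand at the diagonal index already dominates
  the entry of \<open>\<phi>\<close>, and the join dominates that summand. This is the half of the
  unit laws that every family satisfies.\<close>

lemma comp_hm_le:
  assumes "qcategory Q X" "qcategory Q Y" "\<phi> \<in> families Q X Y"
  shows "dist_le Q X Y \<phi> (dist_comp Q X X Y \<phi> (hm X))"
    and "dist_le Q X Y \<phi> (dist_comp Q X Y Y (hm Y) \<phi>)"
proof -
  note ty = assms(1,2)[THEN qcategory_ty]
  note fam = hm_families[OF assms(1)] hm_families[OF assms(2)] assms(3)
  note arr = fam[THEN families_arrow]
  show "dist_le Q X Y \<phi> (dist_comp Q X X Y \<phi> (hm X))"
    unfolding dist_le_def
  proof (intro ballI)
    fix x y assume xy: "x \<in> carrier X" "y \<in> carrier Y"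
    have "\<phi> x y = Comp Q (ty X x) (ty X x) (ty Y y) (\<phi> x y) (Idt Q (ty X x))"
      using xy by (simp add: comp_idt_right ty arr)
    also have "\<dots> \<sqsubseteq>\<^bsub>Hom Q (ty X x) (ty Y y)\<^esub> Comp Q (ty X x) (ty X x) (ty Y y) (\<phi> x y) (hm X x x)"
      using xy assms by (intro comp_mono idt_le_hm arrow_refl) (auto simp: ty arr idt_closed)
    finally have "\<phi> x y \<sqsubseteq>\<^bsub>Hom Q (ty X x) (ty Y y)\<^esub> Comp Q (ty X x) (ty X x) (ty Y y) (\<phi> x y) (hm X x x)" .
    moreover have "Comp Q (ty X x) (ty X x) (ty Y y) (\<phi> x y) (hm X x x)
        \<sqsubseteq>\<^bsub>Hom Q (ty X x) (ty Y y)\<^esub> dist_comp Q X X Y \<phi> (hm X) x y"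
      using xy by (intro comp_le_dist_comp assms fam)
    ultimately show "\<phi> x y \<sqsubseteq>\<^bsub>Hom Q (ty X x) (ty Y y)\<^esub> dist_comp Q X X Y \<phi> (hm X) x y"
      using xy dist_comp_families[OF assms(1,1,2) fam(1,3), THEN families_arrow, OF xy]
      by - (rule arrow_trans[of "ty X x" "ty Y y" "\<phi> x y" "Comp Q (ty X x) (ty X x) (ty Y y) (\<phi> x y) (hm X x x)"],
        simp_all add: ty arr comp_closed)
  qed
  show "dist_le Q X Y \<phi> (dist_comp Q X Y Y (hm Y) \<phi>)"
    unfolding dist_le_def
  proof (intro ballI)
    fix x y assume xy: "x \<in> carrier X" "y \<in> carrier Y"
    have "\<phi> x y = Comp Q (ty X x) (ty Y y) (ty Y y) (Idt Q (ty Y y)) (\<phi> x y)"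
      using xy by (simp add: comp_idt_left ty arr)
    also have "\<dots> \<sqsubseteq>\<^bsub>Hom Q (ty X x) (ty Y y)\<^esub> Comp Q (ty X x) (ty Y y) (ty Y y) (hm Y y y) (\<phi> x y)"
      using xy assms by (intro comp_mono idt_le_hm arrow_refl) (auto simp: ty arr idt_closed)
    finally have "\<phi> x y \<sqsubseteq>\<^bsub>Hom Q (ty X x) (ty Y y)\<^esub> Comp Q (ty X x) (ty Y y) (ty Y y) (hm Y y y) (\<phi> x y)" .
    moreover have "Comp Q (ty X x) (ty Y y) (ty Y y) (hm Y y y) (\<phi> x y)
        \<sqsubseteq>\<^bsub>Hom Q (ty X x) (ty Y y)\<^esub> dist_comp Q X Y Y (hm Y) \<phi> x y"
      using xy by (intro comp_le_dist_comp assms fam)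
    ultimately show "\<phi> x y \<sqsubseteq>\<^bsub>Hom Q (ty X x) (ty Y y)\<^esub> dist_comp Q X Y Y (hm Y) \<phi> x y"
      using xy dist_comp_families[OF assms(1,2,2) fam(3,2), THEN families_arrow, OF xy]
      by - (rule arrow_trans[of "ty X x" "ty Y y" "\<phi> x y" "Comp Q (ty X x) (ty Y y) (ty Y y) (hm Y y y) (\<phi> x y)"],
        simp_all add: ty arr comp_closed)
  qed
qed

text \<open>Padding the missing side by \<open>comp_hm_le\<close> leads from the two-sided law to
  each one-sided law; applying the one-sided laws in turn leads back. Together with
  \<open>comp_hm_le\<close>, distributors become exactly the families on which the hom-families act
  as identities, so later closure properties need no entries.\<close>

lemma distributor_iff:
  assumes X: "qcategory Q X" and Y: "qcategory Q Y"
  shows "distributor Q X Y \<phi> \<longleftrightarrow> \<phi> \<in> families Q X Y \<and>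
    dist_le Q X Y (dist_comp Q X X Y \<phi> (hm X)) \<phi> \<and> dist_le Q X Y (dist_comp Q X Y Y (hm Y) \<phi>) \<phi>"
proof (cases "\<phi> \<in> families Q X Y")
  case fam: True
  note hX = hm_families[OF X] and hY = hm_families[OF Y]
  let ?r = "dist_comp Q X X Y \<phi> (hm X)"
  have r: "?r \<in> families Q X Y" using X Y fam hX by (intro dist_comp_families)
  have lr: "dist_comp Q X Y Y (hm Y) ?r \<in> families Q X Y" "dist_comp Q X Y Y (hm Y) \<phi> \<in> families Q X Y"
    using X Y fam r hY by (auto intro!: dist_comp_families)
  have "distributor Q X Y \<phi> \<longleftrightarrow> dist_le Q X Y (dist_comp Q X Y Y (hm Y) ?r) \<phi>"
  proof -
    have "Comp Q (ty X x') (ty Y y) (ty Y y') (hm Y y y') (?r x' y)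
        \<sqsubseteq>\<^bsub>Hom Q (ty X x') (ty Y y')\<^esub> \<phi> x' y' \<longleftrightarrow>
      (\<forall>x\<in>carrier X. Comp Q (ty X x') (ty Y y) (ty Y y') (hm Y y y')
        (Comp Q (ty X x') (ty X x) (ty Y y) (\<phi> x y) (hm X x' x))
        \<sqsubseteq>\<^bsub>Hom Q (ty X x') (ty Y y')\<^esub> \<phi> x' y')"
      if "x' \<in> carrier X" "y \<in> carrier Y" "y' \<in> carrier Y" for x' y y'
      using that dist_comp_arrows[OF X X Y hX fam that(1,2)]
      by (simp add: dist_comp_def comp_sup_right_le_iff qcategory_ty[OF X] qcategory_ty[OF Y]
          families_arrow[OF fam] families_arrow[OF hX] families_arrow[OF hY])
    then show ?thesis
      using fam by (auto simp: distributor_def dist_comp_le_iff[OF X Y Y r hY fam])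
  qed
  also have "\<dots> \<longleftrightarrow> dist_le Q X Y ?r \<phi> \<and> dist_le Q X Y (dist_comp Q X Y Y (hm Y) \<phi>) \<phi>"
  proof (intro iffI conjI)
    assume le: "dist_le Q X Y (dist_comp Q X Y Y (hm Y) ?r) \<phi>"
    show "dist_le Q X Y ?r \<phi>"
      using dist_le_trans[OF X Y r lr(1) fam comp_hm_le(2)[OF X Y r] le] .
    have "dist_le Q X Y (dist_comp Q X Y Y (hm Y) \<phi>) (dist_comp Q X Y Y (hm Y) ?r)"
      using X Y r fam hY by (intro dist_comp_mono comp_hm_le dist_le_refl)
    then show "dist_le Q X Y (dist_comp Q X Y Y (hm Y) \<phi>) \<phi>"
      using dist_le_trans[OF X Y lr(2,1) fam] le by blast
  next
    assume le: "dist_le Q X Y ?r \<phi> \<and> dist_le Q X Y (dist_comp Q X Y Y (hm Y) \<phi>) \<phi>"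
    then have "dist_le Q X Y (dist_comp Q X Y Y (hm Y) ?r) (dist_comp Q X Y Y (hm Y) \<phi>)"
      using X Y r fam hY by (intro dist_comp_mono dist_le_refl) auto
    with le show "dist_le Q X Y (dist_comp Q X Y Y (hm Y) ?r) \<phi>"
      using dist_le_trans[OF X Y lr fam] by blast
  qed
  finally show ?thesis using fam by simp
qed (simp add: distributor_def)

lemma distributor_hm:
  assumes X: "qcategory Q X" shows "distributor Q X X (hm X)"
proof -
  have "dist_le Q X X (dist_comp Q X X X (hm X) (hm X)) (hm X)"
    unfolding dist_comp_le_iff[OF X X X hm_families[OF X] hm_families[OF X] hm_families[OF X]]
    using X by (auto simp: qcategory_def)
  then show ?thesis using X by (simp add: distributor_iff hm_families)
qed

lemma dist_comp_hm_right:
  assumes "qcategory Q X" "qcategory Q Y" "distributor Q X Y \<phi>"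
  shows "dist_comp Q X X Y \<phi> (hm X) = \<phi>"
proof -
  have fam: "\<phi> \<in> families Q X Y" and le: "dist_le Q X Y (dist_comp Q X X Y \<phi> (hm X)) \<phi>"
    using assms by (simp_all add: distributor_iff)
  show ?thesis
    using assms fam
    by (intro dist_le_antisym[OF _ _ _ _ le] comp_hm_le dist_comp_families hm_families) auto
qed

lemma dist_comp_hm_left:
  assumes "qcategory Q X" "qcategory Q Y" "distributor Q X Y \<phi>"
  shows "dist_comp Q X Y Y (hm Y) \<phi> = \<phi>"
proof -
  have fam: "\<phi> \<in> families Q X Y" and le: "dist_le Q X Y (dist_comp Q X Y Y (hm Y) \<phi>) \<phi>"
    using assms by (simp_all add: distributor_iff)
  show ?thesis
    using assms fam
    by (intro dist_le_antisym[OF _ _ _ _ le] comp_hm_le dist_comp_families hm_families) auto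
qed

text \<open>By associativity, \<open>hm X\<close> meets \<open>\<phi>\<close> and
  \<open>hm Z\<close> meets \<open>\<psi>\<close>, and each is absorbed there.\<close>

lemma distributor_dist_comp:
  assumes X: "qcategory Q X" and Y: "qcategory Q Y" and Z: "qcategory Q Z"
    and \<phi>: "distributor Q X Y \<phi>" and \<psi>: "distributor Q Y Z \<psi>"
  shows "distributor Q X Z (dist_comp Q X Y Z \<psi> \<phi>)"
proof -
  note fam = \<phi>[THEN distributor_families] \<psi>[THEN distributor_families]
  have comp: "dist_comp Q X Y Z \<psi> \<phi> \<in> families Q X Z"
    using X Y Z fam by (rule dist_comp_families)
  have "dist_comp Q X X Z (dist_comp Q X Y Z \<psi> \<phi>) (hm X) = dist_comp Q X Y Z \<psi> \<phi>"
    using dist_comp_assoc[OF X X Y Z hm_families[OF X] fam] dist_comp_hm_right[OF X Y \<phi>] by simp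
  moreover have "dist_comp Q X Z Z (hm Z) (dist_comp Q X Y Z \<psi> \<phi>) = dist_comp Q X Y Z \<psi> \<phi>"
    using dist_comp_assoc[OF X Y Z Z fam hm_families[OF Z]] dist_comp_hm_left[OF Y Z \<psi>] by simp
  ultimately show ?thesis
    using comp dist_le_refl[OF X Z comp] by (simp add: distributor_iff[OF X Z])
qed

text \<open>Both actions on the residual \<open>?r\<close> are tested after composition with
  \<open>\<phi>\<close>. There \<open>hm Y\<close> is absorbed by \<open>\<phi>\<close>, while
  \<open>hm Z\<close> is absorbed by the bound \<open>\<xi>\<close> of
  \<open>?r \<circ> \<phi>\<close>.\<close>

lemma distributor_dist_residual:
  assumes X: "qcategory Q X" and Y: "qcategory Q Y" and Z: "qcategory Q Z"
    and \<phi>: "distributor Q X Y \<phi>" and \<xi>: "distributor Q X Z \<xi>"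
  shows "distributor Q Y Z (dist_residual Q X Y Z \<xi> \<phi>)"
proof -
  let ?r = "dist_residual Q X Y Z \<xi> \<phi>"
  note \<phi>' = distributor_families[OF \<phi>] and \<xi>' = distributor_families[OF \<xi>]
  note hY = hm_families[OF Y] and hZ = hm_families[OF Z]
  have r: "?r \<in> families Q Y Z" using X Y Z \<phi>' \<xi>' by (rule dist_residual_families)
  have r\<phi>: "dist_comp Q X Y Z ?r \<phi> \<in> families Q X Z"
    using X Y Z \<phi>' r by (rule dist_comp_families)
  have le: "dist_le Q X Z (dist_comp Q X Y Z ?r \<phi>) \<xi>"
    using X Y Z \<phi>' \<xi>' by (rule dist_residual_comp_le)
  have "dist_le Q Y Z (dist_comp Q Y Y Z ?r (hm Y)) ?r"
    using le_dist_residual_iff[OF X Y Z \<phi>' \<xi>' dist_comp_families[OF Y Y Z hY r]]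
      dist_comp_assoc[OF X Y Y Z \<phi>' hY r] dist_comp_hm_left[OF X Y \<phi>] le by simp
  moreover have "dist_le Q X Z (dist_comp Q X Z Z (hm Z) (dist_comp Q X Y Z ?r \<phi>)) \<xi>"
    using dist_comp_mono[OF X Z Z r\<phi> \<xi>' hZ hZ le] dist_le_refl[OF Z Z hZ]
      dist_comp_hm_left[OF X Z \<xi>] by simp
  then have "dist_le Q Y Z (dist_comp Q Y Z Z (hm Z) ?r) ?r"
    using le_dist_residual_iff[OF X Y Z \<phi>' \<xi>' dist_comp_families[OF Y Z Z r hZ]]
      dist_comp_assoc[OF X Y Z Z \<phi>' r hZ] by simp
  ultimately show ?thesis using r by (simp add: distributor_iff[OF Y Z])
qed

section \<open>Pointwise suprema of families and of distributors\<close>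

definition dist_sup ::
  "('a, 'o, 'm) qcat \<Rightarrow> ('b, 'o, 'm) qcat \<Rightarrow> ('a \<Rightarrow> 'b \<Rightarrow> 'm) set \<Rightarrow> ('a \<Rightarrow> 'b \<Rightarrow> 'm)" where
  "dist_sup X Y S = (\<lambda>x \<in> carrier X. \<lambda>y \<in> carrier Y. \<Squnion>\<^bsub>Hom Q (ty X x) (ty Y y)\<^esub> ((\<lambda>\<phi>. \<phi> x y) ` S))"

lemma dist_sup_families:
  assumes "qcategory Q X" "qcategory Q Y" "S \<subseteq> families Q X Y"
  shows "dist_sup X Y S \<in> families Q X Y"
  unfolding dist_sup_def using assms
  by (intro restrict_families sup_closed) (auto intro: qcategory_ty families_arrow)

lemma dist_sup_le_iff:
  assumes "qcategory Q X" "qcategory Q Y" "S \<subseteq> families Q X Y" "\<xi> \<in> families Q X Y"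
  shows "dist_le Q X Y (dist_sup X Y S) \<xi> \<longleftrightarrow> (\<forall>\<phi>\<in>S. dist_le Q X Y \<phi> \<xi>)"
proof -
  have "dist_sup X Y S x y \<sqsubseteq>\<^bsub>Hom Q (ty X x) (ty Y y)\<^esub> \<xi> x y \<longleftrightarrow>
      (\<forall>\<phi>\<in>S. \<phi> x y \<sqsubseteq>\<^bsub>Hom Q (ty X x) (ty Y y)\<^esub> \<xi> x y)"
    if "x \<in> carrier X" "y \<in> carrier Y" for x y
  proof -
    have "(\<lambda>\<phi>. \<phi> x y) ` S \<subseteq> Arrows Q (ty X x) (ty Y y)"
      using that assms(3) by (auto intro: families_arrow)
    with that assms show ?thesis
      by (simp add: dist_sup_def sup_le_iff qcategory_ty families_arrow)
  qed
  then show ?thesis unfolding dist_le_def by blast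
qed

lemma le_dist_sup:
  assumes "qcategory Q X" "qcategory Q Y" "S \<subseteq> families Q X Y" "\<phi> \<in> S"
  shows "dist_le Q X Y \<phi> (dist_sup X Y S)"
  using dist_sup_le_iff[OF assms(1-3) dist_sup_families[OF assms(1-3)]]
    dist_le_refl[OF assms(1,2) dist_sup_families[OF assms(1-3)]] assms(4) by blast

text \<open>Composition with a fixed \<open>\<phi>\<close> on the right is a left adjoint, by
  \<open>le_dist_residual_iff\<close>, and therefore respects suprema.\<close>

lemma comp_dist_sup_left_le_iff:
  assumes X: "qcategory Q X" and Y: "qcategory Q Y" and Z: "qcategory Q Z"
    and \<phi>: "\<phi> \<in> families Q X Y" and S: "S \<subseteq> families Q Y Z" and \<xi>: "\<xi> \<in> families Q X Z"
  shows "dist_le Q X Z (dist_comp Q X Y Z (dist_sup Y Z S) \<phi>) \<xi> \<longleftrightarrow>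
    (\<forall>\<psi>\<in>S. dist_le Q X Z (dist_comp Q X Y Z \<psi> \<phi>) \<xi>)"
proof -
  have "dist_le Q X Z (dist_comp Q X Y Z (dist_sup Y Z S) \<phi>) \<xi> \<longleftrightarrow>
      dist_le Q Y Z (dist_sup Y Z S) (dist_residual Q X Y Z \<xi> \<phi>)"
    by (rule le_dist_residual_iff[OF X Y Z \<phi> \<xi> dist_sup_families[OF Y Z S], symmetric])
  also have "\<dots> \<longleftrightarrow> (\<forall>\<psi>\<in>S. dist_le Q Y Z \<psi> (dist_residual Q X Y Z \<xi> \<phi>))"
    by (rule dist_sup_le_iff[OF Y Z S dist_residual_families[OF X Y Z \<phi> \<xi>]])
  also have "\<dots> \<longleftrightarrow> (\<forall>\<psi>\<in>S. dist_le Q X Z (dist_comp Q X Y Z \<psi> \<phi>) \<xi>)"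
    using S by (intro ball_cong refl le_dist_residual_iff[OF X Y Z \<phi> \<xi>]) auto
  finally show ?thesis .
qed

text \<open>The adjoint for this side would be the opposite residual
  \<open>\<psi> \<searrow> \<xi>\<close>, which is not introduced; the join is instead pulled out at
  each entry by the axiom of \<open>Q\<close>.\<close>

lemma comp_dist_sup_right_le_iff:
  assumes X: "qcategory Q X" and Y: "qcategory Q Y" and Z: "qcategory Q Z"
    and S: "S \<subseteq> families Q X Y" and \<psi>: "\<psi> \<in> families Q Y Z" and \<xi>: "\<xi> \<in> families Q X Z"
  shows "dist_le Q X Z (dist_comp Q X Y Z \<psi> (dist_sup X Y S)) \<xi> \<longleftrightarrow>
    (\<forall>\<phi>\<in>S. dist_le Q X Z (dist_comp Q X Y Z \<psi> \<phi>) \<xi>)"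
proof -
  have "Comp Q (ty X x) (ty Y y) (ty Z z) (\<psi> y z) (dist_sup X Y S x y)
        \<sqsubseteq>\<^bsub>Hom Q (ty X x) (ty Z z)\<^esub> \<xi> x z \<longleftrightarrow>
      (\<forall>\<phi>\<in>S. Comp Q (ty X x) (ty Y y) (ty Z z) (\<psi> y z) (\<phi> x y)
        \<sqsubseteq>\<^bsub>Hom Q (ty X x) (ty Z z)\<^esub> \<xi> x z)"
    if "x \<in> carrier X" "y \<in> carrier Y" "z \<in> carrier Z" for x y z
  proof -
    have "(\<lambda>\<phi>. \<phi> x y) ` S \<subseteq> Arrows Q (ty X x) (ty Y y)"
      using that S by (auto intro: families_arrow)
    with that show ?thesis
      by (simp add: dist_sup_def comp_sup_right_le_iff qcategory_ty[OF X] qcategory_ty[OF Y]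
          qcategory_ty[OF Z] families_arrow[OF \<psi>] families_arrow[OF \<xi>])
  qed
  moreover have "dist_le Q X Z (dist_comp Q X Y Z \<psi> \<phi>) \<xi> \<longleftrightarrow>
    (\<forall>x \<in> carrier X. \<forall>y \<in> carrier Y. \<forall>z \<in> carrier Z.
      Comp Q (ty X x) (ty Y y) (ty Z z) (\<psi> y z) (\<phi> x y) \<sqsubseteq>\<^bsub>Hom Q (ty X x) (ty Z z)\<^esub> \<xi> x z)"
    if "\<phi> \<in> S" for \<phi>
    using that S by (intro dist_comp_le_iff[OF X Y Z _ \<psi> \<xi>]) auto
  ultimately show ?thesis
    unfolding dist_comp_le_iff[OF X Y Z dist_sup_families[OF X Y S] \<psi> \<xi>] by auto
qed

lemma distributor_dist_sup:
  assumes X: "qcategory Q X" and Y: "qcategory Q Y" and S: "\<And>\<phi>. \<phi> \<in> S \<Longrightarrow> distributor Q X Y \<phi>"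
  shows "distributor Q X Y (dist_sup X Y S)"
proof -
  have fam: "S \<subseteq> families Q X Y" using S by (auto intro: distributor_families)
  note sup = dist_sup_families[OF X Y fam]
  have "dist_le Q X Y (dist_comp Q X X Y (dist_sup X Y S) (hm X)) (dist_sup X Y S)"
    unfolding comp_dist_sup_left_le_iff[OF X X Y hm_families[OF X] fam sup]
    by (simp add: dist_comp_hm_right[OF X Y] S le_dist_sup[OF X Y fam])
  moreover have "dist_le Q X Y (dist_comp Q X Y Y (hm Y) (dist_sup X Y S)) (dist_sup X Y S)"
    unfolding comp_dist_sup_right_le_iff[OF X Y Y fam hm_families[OF Y] sup]
    by (simp add: dist_comp_hm_left[OF X Y] S le_dist_sup[OF X Y fam])
  ultimately show ?thesis
    unfolding distributor_iff[OF X Y] using sup by blast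
qed

section \<open>Distributors form a quantaloid\<close>

lemma QDist_simps:
  "Ob (QDist Q) = {X. qcategory Q X}"
  "Arrows (QDist Q) X Y = {\<phi>. distributor Q X Y \<phi>}"
  "\<phi> \<sqsubseteq>\<^bsub>Hom (QDist Q) X Y\<^esub> \<psi> \<longleftrightarrow> dist_le Q X Y \<phi> \<psi>"
  "Comp (QDist Q) = dist_comp Q"
  "Idt (QDist Q) = hm"
  by (simp_all add: QDist_def)

lemma QDist_complete_lattice:
  assumes X: "qcategory Q X" and Y: "qcategory Q Y"
  shows "complete_lattice (Hom (QDist Q) X Y)"
proof (rule complete_lattice_supI)
  show "(.=\<^bsub>Hom (QDist Q) X Y\<^esub>) = (=)" by (simp add: QDist_def)
  fix A assume "A \<subseteq> Arrows (QDist Q) X Y"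
  then have A: "\<And>\<phi>. \<phi> \<in> A \<Longrightarrow> distributor Q X Y \<phi>" by (auto simp: QDist_simps)
  then have fam: "A \<subseteq> families Q X Y" by (auto intro: distributor_families)
  show "\<exists>s\<in>Arrows (QDist Q) X Y. \<forall>w\<in>Arrows (QDist Q) X Y. s \<sqsubseteq>\<^bsub>Hom (QDist Q) X Y\<^esub> w
      \<longleftrightarrow> (\<forall>a\<in>A. a \<sqsubseteq>\<^bsub>Hom (QDist Q) X Y\<^esub> w)"
  proof (rule bexI[of _ "dist_sup X Y A"])
    show "dist_sup X Y A \<in> Arrows (QDist Q) X Y"
      using distributor_dist_sup[OF X Y A] by (simp add: QDist_simps)
    show "\<forall>w\<in>Arrows (QDist Q) X Y. dist_sup X Y A \<sqsubseteq>\<^bsub>Hom (QDist Q) X Y\<^esub> w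
        \<longleftrightarrow> (\<forall>a\<in>A. a \<sqsubseteq>\<^bsub>Hom (QDist Q) X Y\<^esub> w)"
      unfolding QDist_simps by (simp add: dist_sup_le_iff[OF X Y fam] distributor_families)
  qed
next
  fix \<phi> \<psi> \<xi>
  assume "\<phi> \<in> Arrows (QDist Q) X Y" "\<psi> \<in> Arrows (QDist Q) X Y" "\<xi> \<in> Arrows (QDist Q) X Y"
    "\<phi> \<sqsubseteq>\<^bsub>Hom (QDist Q) X Y\<^esub> \<psi>" "\<psi> \<sqsubseteq>\<^bsub>Hom (QDist Q) X Y\<^esub> \<xi>"
  then show "\<phi> \<sqsubseteq>\<^bsub>Hom (QDist Q) X Y\<^esub> \<xi>"
    unfolding QDist_simps by (intro dist_le_trans[OF X Y, of \<phi> \<psi> \<xi>]) (auto intro: distributor_families)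
qed (simp_all add: QDist_simps distributor_families dist_le_refl[OF X Y] dist_le_antisym[OF X Y])

text \<open>The lattice structure provides joins only through their universal property; this
  identifies them with the pointwise formula, on which composition can be computed.\<close>

lemma QDist_sup_eq:
  assumes X: "qcategory Q X" and Y: "qcategory Q Y" and S: "\<And>\<phi>. \<phi> \<in> S \<Longrightarrow> distributor Q X Y \<phi>"
  shows "\<Squnion>\<^bsub>Hom (QDist Q) X Y\<^esub> S = dist_sup X Y S"
proof (rule complete_lattice.sup_eqI[OF QDist_complete_lattice[OF X Y]])
  have fam: "S \<subseteq> families Q X Y" using S by (auto intro: distributor_families)
  fix w assume "w \<in> Arrows (QDist Q) X Y"
  then show "dist_sup X Y S \<sqsubseteq>\<^bsub>Hom (QDist Q) X Y\<^esub> w \<longleftrightarrow> (\<forall>a\<in>S. a \<sqsubseteq>\<^bsub>Hom (QDist Q) X Y\<^esub> w)"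
    by (simp add: QDist_simps dist_sup_le_iff[OF X Y fam] distributor_families)
qed (use S in \<open>auto simp: QDist_simps distributor_dist_sup[OF X Y]\<close>)

theorem quantaloid_QDist:
  "quantaloid (QDist Q :: (('a, 'o, 'm) qcat, 'a \<Rightarrow> 'a \<Rightarrow> 'm) quantaloid_struct)"
proof (rule quantaloid.intro, unfold QDist_simps mem_Collect_eq)
  fix X Y Z :: "('a, 'o, 'm) qcat" and A :: "('a \<Rightarrow> 'a \<Rightarrow> 'm) set" and v
  assume X: "qcategory Q X" and Y: "qcategory Q Y" and Z: "qcategory Q Z"
    and "A \<subseteq> {\<phi>. distributor Q X Y \<phi>}" and v: "distributor Q Y Z v"
  then have A: "\<And>\<phi>. \<phi> \<in> A \<Longrightarrow> distributor Q X Y \<phi>" by auto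
  then have fam: "A \<subseteq> families Q X Y" by (auto intro: distributor_families)
  have img: "\<phi> \<in> dist_comp Q X Y Z v ` A \<Longrightarrow> distributor Q X Z \<phi>" for \<phi>
    using A v by (auto intro: distributor_dist_comp[OF X Y Z])
  then have img': "dist_comp Q X Y Z v ` A \<subseteq> families Q X Z" by (auto intro: distributor_families)
  \<comment> \<open>Both sides have the same upper bounds: the \<open>\<xi>\<close> with
    \<open>v \<circ> \<phi> \<le> \<xi>\<close> for all \<open>\<phi>\<close> in
    \<open>A\<close>.\<close>
  have "dist_comp Q X Y Z v (dist_sup X Y A) = dist_sup X Z (dist_comp Q X Y Z v ` A)"
    using fam v img'
    by (intro dist_le_eqI[OF X Z])
      (simp_all add: comp_dist_sup_right_le_iff[OF X Y Z] dist_sup_le_iff[OF X Z]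
        distributor_families dist_comp_families[OF X Y Z] dist_sup_families X Y Z)
  then show "dist_comp Q X Y Z v (\<Squnion>\<^bsub>Hom (QDist Q) X Y\<^esub> A) =
      \<Squnion>\<^bsub>Hom (QDist Q) X Z\<^esub> (dist_comp Q X Y Z v ` A)"
    by (simp add: QDist_sup_eq[OF X Y A] QDist_sup_eq[OF X Z img])
next
  fix X Y Z :: "('a, 'o, 'm) qcat" and B :: "('a \<Rightarrow> 'a \<Rightarrow> 'm) set" and u
  assume X: "qcategory Q X" and Y: "qcategory Q Y" and Z: "qcategory Q Z"
    and u: "distributor Q X Y u" and "B \<subseteq> {\<phi>. distributor Q Y Z \<phi>}"
  then have B: "\<And>\<phi>. \<phi> \<in> B \<Longrightarrow> distributor Q Y Z \<phi>" by auto
  then have fam: "B \<subseteq> families Q Y Z" by (auto intro: distributor_families)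
  let ?f = "\<lambda>v. dist_comp Q X Y Z v u"
  have img: "\<phi> \<in> ?f ` B \<Longrightarrow> distributor Q X Z \<phi>" for \<phi>
    using B u by (auto intro: distributor_dist_comp[OF X Y Z])
  then have img': "?f ` B \<subseteq> families Q X Z" by (auto intro: distributor_families)
  have "dist_comp Q X Y Z (dist_sup Y Z B) u = dist_sup X Z (?f ` B)"
    using fam u img'
    by (intro dist_le_eqI[OF X Z])
      (simp_all add: comp_dist_sup_left_le_iff[OF X Y Z] dist_sup_le_iff[OF X Z]
        distributor_families dist_comp_families[OF X Y Z] dist_sup_families X Y Z)
  then show "dist_comp Q X Y Z (\<Squnion>\<^bsub>Hom (QDist Q) Y Z\<^esub> B) u = \<Squnion>\<^bsub>Hom (QDist Q) X Z\<^esub> (?f ` B)"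
    by (simp add: QDist_sup_eq[OF Y Z B] QDist_sup_eq[OF X Z img])
qed (simp_all add: QDist_complete_lattice distributor_hm distributor_dist_comp dist_comp_hm_left
    dist_comp_hm_right dist_comp_assoc distributor_families)


section \<open>The arrow quantaloid\<close>

lemma Arr_simps:
  "Ob (Arr Q) = {(X, Y, \<phi>). X \<in> Ob Q \<and> Y \<in> Ob Q \<and> \<phi> \<in> Arrows Q X Y}"
  "Arrows (Arr Q) (X, Y, \<phi>) (X', Y', \<psi>) = {(\<zeta>, \<eta>). \<zeta> \<in> Arrows Q X X' \<and> \<eta> \<in> Arrows Q Y Y' \<and>
     Comp Q X X' Y' \<psi> \<zeta> = Comp Q X Y Y' \<eta> \<phi>}"
  "(\<zeta>, \<eta>) \<sqsubseteq>\<^bsub>Hom (Arr Q) (X, Y, \<phi>) (X', Y', \<psi>)\<^esub> (\<zeta>', \<eta>')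
    \<longleftrightarrow> \<zeta> \<sqsubseteq>\<^bsub>Hom Q X X'\<^esub> \<zeta>' \<and> \<eta> \<sqsubseteq>\<^bsub>Hom Q Y Y'\<^esub> \<eta>'"
  "Comp (Arr Q) (X, Y, \<phi>) (X', Y', \<psi>) (X'', Y'', \<chi>) (\<zeta>', \<eta>') (\<zeta>, \<eta>)
    = (Comp Q X X' X'' \<zeta>' \<zeta>, Comp Q Y Y' Y'' \<eta>' \<eta>)"
  "Idt (Arr Q) (X, Y, \<phi>) = (Idt Q X, Idt Q Y)"
  by (simp_all add: Arr_def)

text \<open>Squares are stable under componentwise joins because composition preserves joins in both
  variables: \<open>\<psi>\<close> passes under the join of the first components, the squares
  commute one by one, and \<open>\<phi>\<close> is taken out of the join of the second
  components.\<close>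

lemma Arr_sup_closed:
  assumes ob: "X \<in> Ob Q" "Y \<in> Ob Q" "\<phi> \<in> Arrows Q X Y" "X' \<in> Ob Q" "Y' \<in> Ob Q" "\<psi> \<in> Arrows Q X' Y'"
    and S: "S \<subseteq> Arrows (Arr Q) (X, Y, \<phi>) (X', Y', \<psi>)"
  shows "(\<Squnion>\<^bsub>Hom Q X X'\<^esub> (fst ` S), \<Squnion>\<^bsub>Hom Q Y Y'\<^esub> (snd ` S)) \<in> Arrows (Arr Q) (X, Y, \<phi>) (X', Y', \<psi>)"
proof -
  have S1: "fst ` S \<subseteq> Arrows Q X X'" and S2: "snd ` S \<subseteq> Arrows Q Y Y'"
    using S by (auto simp: Arr_simps)
  have "Comp Q X X' Y' \<psi> (\<Squnion>\<^bsub>Hom Q X X'\<^esub> (fst ` S)) = \<Squnion>\<^bsub>Hom Q X Y'\<^esub> ((\<lambda>s. Comp Q X X' Y' \<psi> (fst s)) ` S)"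
    using ob S1 by (simp add: comp_join_right image_image)
  also have "(\<lambda>s. Comp Q X X' Y' \<psi> (fst s)) ` S = (\<lambda>s. Comp Q X Y Y' (snd s) \<phi>) ` S"
    using S by (intro image_cong) (auto simp: Arr_simps)
  also have "\<Squnion>\<^bsub>Hom Q X Y'\<^esub> \<dots> = Comp Q X Y Y' (\<Squnion>\<^bsub>Hom Q Y Y'\<^esub> (snd ` S)) \<phi>"
    using ob S2 by (simp add: comp_join_left image_image)
  finally show ?thesis
    using ob S1 S2 by (simp add: Arr_simps sup_closed)
qed

lemma Arr_sup_le_iff:
  assumes ob: "X \<in> Ob Q" "Y \<in> Ob Q" "X' \<in> Ob Q" "Y' \<in> Ob Q"
    and S: "S \<subseteq> Arrows (Arr Q) (X, Y, \<phi>) (X', Y', \<psi>)"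
    and w: "w \<in> Arrows (Arr Q) (X, Y, \<phi>) (X', Y', \<psi>)"
  shows "(\<Squnion>\<^bsub>Hom Q X X'\<^esub> (fst ` S), \<Squnion>\<^bsub>Hom Q Y Y'\<^esub> (snd ` S)) \<sqsubseteq>\<^bsub>Hom (Arr Q) (X, Y, \<phi>) (X', Y', \<psi>)\<^esub> w
    \<longleftrightarrow> (\<forall>s\<in>S. s \<sqsubseteq>\<^bsub>Hom (Arr Q) (X, Y, \<phi>) (X', Y', \<psi>)\<^esub> w)"
proof -
  have S1: "fst ` S \<subseteq> Arrows Q X X'" and S2: "snd ` S \<subseteq> Arrows Q Y Y'"
    using S by (auto simp: Arr_simps)
  obtain \<zeta> \<eta> where "w = (\<zeta>, \<eta>)" "\<zeta> \<in> Arrows Q X X'" "\<eta> \<in> Arrows Q Y Y'"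
    using w by (auto simp: Arr_simps)
  with ob S1 S2 show ?thesis
    by (fastforce simp: Arr_simps sup_le_iff)
qed

text \<open>Only the suprema are described explicitly, as componentwise ones; infima come from
  \<open>complete_lattice_supI\<close>, and no componentwise formula is claimed for them.\<close>

lemma Arr_complete_lattice:
  assumes ob: "X \<in> Ob Q" "Y \<in> Ob Q" "\<phi> \<in> Arrows Q X Y" "X' \<in> Ob Q" "Y' \<in> Ob Q" "\<psi> \<in> Arrows Q X' Y'"
  shows "complete_lattice (Hom (Arr Q) (X, Y, \<phi>) (X', Y', \<psi>))" (is "complete_lattice ?H")
proof (rule complete_lattice_supI)
  show "(.=\<^bsub>?H\<^esub>) = (=)" by (simp add: Arr_def)
  show "\<exists>s\<in>carrier ?H. \<forall>w\<in>carrier ?H. s \<sqsubseteq>\<^bsub>?H\<^esub> w \<longleftrightarrow> (\<forall>a\<in>A. a \<sqsubseteq>\<^bsub>?H\<^esub> w)" if "A \<subseteq> carrier ?H" for A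
    using Arr_sup_closed[OF ob that] Arr_sup_le_iff[OF ob(1,2,4,5) that] by blast
next
  fix u v w assume "u \<in> carrier ?H" "v \<in> carrier ?H" "w \<in> carrier ?H" "u \<sqsubseteq>\<^bsub>?H\<^esub> v" "v \<sqsubseteq>\<^bsub>?H\<^esub> w"
  then show "u \<sqsubseteq>\<^bsub>?H\<^esub> w"
    using arrow_trans[OF ob(1,4), of "fst u" "fst v" "fst w"]
      arrow_trans[OF ob(2,5), of "snd u" "snd v" "snd w"]
    by (auto simp: Arr_simps)
qed (auto simp: Arr_simps arrow_refl ob intro: arrow_antisym[OF ob(1,4)] arrow_antisym[OF ob(2,5)])

lemma Arr_sup_eq:
  assumes ob: "X \<in> Ob Q" "Y \<in> Ob Q" "\<phi> \<in> Arrows Q X Y" "X' \<in> Ob Q" "Y' \<in> Ob Q" "\<psi> \<in> Arrows Q X' Y'"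
    and S: "S \<subseteq> Arrows (Arr Q) (X, Y, \<phi>) (X', Y', \<psi>)"
  shows "\<Squnion>\<^bsub>Hom (Arr Q) (X, Y, \<phi>) (X', Y', \<psi>)\<^esub> S = (\<Squnion>\<^bsub>Hom Q X X'\<^esub> (fst ` S), \<Squnion>\<^bsub>Hom Q Y Y'\<^esub> (snd ` S))"
  by (rule complete_lattice.sup_eqI[OF Arr_complete_lattice[OF ob] S Arr_sup_closed[OF ob S]])
    (rule Arr_sup_le_iff[OF ob(1,2,4,5) S])

text \<open>The pasting of two commuting squares: \<open>\<chi>\<close> is moved across the second
  square and then \<open>\<psi>\<close> across the first.\<close>

lemma Arr_comp_closed:
  assumes ob: "X \<in> Ob Q" "Y \<in> Ob Q" "\<phi> \<in> Arrows Q X Y" "X' \<in> Ob Q" "Y' \<in> Ob Q" "\<psi> \<in> Arrows Q X' Y'"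
    "X'' \<in> Ob Q" "Y'' \<in> Ob Q" "\<chi> \<in> Arrows Q X'' Y''"
    and u: "u \<in> Arrows (Arr Q) (X, Y, \<phi>) (X', Y', \<psi>)"
    and v: "v \<in> Arrows (Arr Q) (X', Y', \<psi>) (X'', Y'', \<chi>)"
  shows "Comp (Arr Q) (X, Y, \<phi>) (X', Y', \<psi>) (X'', Y'', \<chi>) v u \<in> Arrows (Arr Q) (X, Y, \<phi>) (X'', Y'', \<chi>)"
proof -
  obtain \<zeta> \<eta> where u_eq: "u = (\<zeta>, \<eta>)" and \<zeta>: "\<zeta> \<in> Arrows Q X X'" and \<eta>: "\<eta> \<in> Arrows Q Y Y'"
    and sq: "Comp Q X X' Y' \<psi> \<zeta> = Comp Q X Y Y' \<eta> \<phi>"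
    using u by (auto simp: Arr_simps)
  obtain \<zeta>' \<eta>' where v_eq: "v = (\<zeta>', \<eta>')" and \<zeta>': "\<zeta>' \<in> Arrows Q X' X''" and \<eta>': "\<eta>' \<in> Arrows Q Y' Y''"
    and sq': "Comp Q X' X'' Y'' \<chi> \<zeta>' = Comp Q X' Y' Y'' \<eta>' \<psi>"
    using v by (auto simp: Arr_simps)
  have "Comp Q X X'' Y'' \<chi> (Comp Q X X' X'' \<zeta>' \<zeta>) = Comp Q X X' Y'' (Comp Q X' Y' Y'' \<eta>' \<psi>) \<zeta>"
    using comp_assoc[of X X' X'' Y'' \<zeta> \<zeta>' \<chi>] ob \<zeta> \<zeta>' sq' by simp
  also have "\<dots> = Comp Q X Y' Y'' \<eta>' (Comp Q X Y Y' \<eta> \<phi>)"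
    using comp_assoc[of X X' Y' Y'' \<zeta> \<psi> \<eta>'] ob \<zeta> \<eta>' sq by simp
  also have "\<dots> = Comp Q X Y Y'' (Comp Q Y Y' Y'' \<eta>' \<eta>) \<phi>"
    using comp_assoc[of X Y Y' Y'' \<phi> \<eta> \<eta>'] ob \<eta> \<eta>' by simp
  finally show ?thesis
    using ob \<zeta> \<eta> \<zeta>' \<eta>' by (simp add: u_eq v_eq Arr_simps comp_closed)
qed

theorem quantaloid_Arr: "quantaloid (Arr Q)"
proof (rule quantaloid.intro)
  fix p q assume "p \<in> Ob (Arr Q)" "q \<in> Ob (Arr Q)"
  then show "complete_lattice (Hom (Arr Q) p q)"
    by (cases p; cases q) (auto simp: Arr_simps(1) intro: Arr_complete_lattice)
next
  fix p assume "p \<in> Ob (Arr Q)"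
  then show "Idt (Arr Q) p \<in> Arrows (Arr Q) p p"
    by (cases p) (simp add: Arr_simps idt_closed comp_idt_left comp_idt_right)
next
  fix p q r u v
  assume "p \<in> Ob (Arr Q)" "q \<in> Ob (Arr Q)" "r \<in> Ob (Arr Q)"
    "u \<in> Arrows (Arr Q) p q" "v \<in> Arrows (Arr Q) q r"
  then show "Comp (Arr Q) p q r v u \<in> Arrows (Arr Q) p r"
    by (cases p; cases q; cases r) (auto simp: Arr_simps(1) intro!: Arr_comp_closed)
next
  fix p q u
  assume *: "p \<in> Ob (Arr Q)" "q \<in> Ob (Arr Q)" "u \<in> Arrows (Arr Q) p q"
  then show "Comp (Arr Q) p p q u (Idt (Arr Q) p) = u"
    by (cases p; cases q; cases u) (simp add: Arr_simps comp_idt_right)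
  show "Comp (Arr Q) p q q (Idt (Arr Q) q) u = u"
    using * by (cases p; cases q; cases u) (simp add: Arr_simps comp_idt_left)
next
  fix p q r s u v w
  assume "p \<in> Ob (Arr Q)" "q \<in> Ob (Arr Q)" "r \<in> Ob (Arr Q)" "s \<in> Ob (Arr Q)"
    "u \<in> Arrows (Arr Q) p q" "v \<in> Arrows (Arr Q) q r" "w \<in> Arrows (Arr Q) r s"
  then show "Comp (Arr Q) p r s w (Comp (Arr Q) p q r v u) = Comp (Arr Q) p q s (Comp (Arr Q) q r s w v) u"
    by (cases p; cases q; cases r; cases s; cases u; cases v; cases w) (simp add: Arr_simps comp_assoc)
next
  fix p q r A v
  assume *: "p \<in> Ob (Arr Q)" "q \<in> Ob (Arr Q)" "r \<in> Ob (Arr Q)"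
    "A \<subseteq> Arrows (Arr Q) p q" "v \<in> Arrows (Arr Q) q r"
  obtain X Y \<phi> X' Y' \<psi> X'' Y'' \<chi> \<zeta> \<eta> where eqs: "p = (X, Y, \<phi>)" "q = (X', Y', \<psi>)" "r = (X'', Y'', \<chi>)" "v = (\<zeta>, \<eta>)"
    by (metis prod.exhaust)
  have ob: "X \<in> Ob Q" "Y \<in> Ob Q" "\<phi> \<in> Arrows Q X Y" "X' \<in> Ob Q" "Y' \<in> Ob Q" "\<psi> \<in> Arrows Q X' Y'"
    "X'' \<in> Ob Q" "Y'' \<in> Ob Q" "\<chi> \<in> Arrows Q X'' Y''"
    using *(1-3) by (simp_all add: eqs Arr_simps(1))
  let ?c = "Comp (Arr Q) p q r v"
  have img: "?c ` A \<subseteq> Arrows (Arr Q) p r"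
    using *(4,5) unfolding eqs by (auto intro!: Arr_comp_closed ob)
  have A: "fst ` A \<subseteq> Arrows Q X X'" "snd ` A \<subseteq> Arrows Q Y Y'"
    using *(4) by (auto simp: eqs Arr_simps)
  have v: "\<zeta> \<in> Arrows Q X' X''" "\<eta> \<in> Arrows Q Y' Y''" using *(5) by (auto simp: eqs Arr_simps)
  have "?c u = (Comp Q X X' X'' \<zeta> (fst u), Comp Q Y Y' Y'' \<eta> (snd u))" for u
    by (cases u) (simp add: eqs Arr_simps)
  then show "?c (\<Squnion>\<^bsub>Hom (Arr Q) p q\<^esub> A) = \<Squnion>\<^bsub>Hom (Arr Q) p r\<^esub> (?c ` A)"
    using Arr_sup_eq[OF ob(1-6) *(4)[unfolded eqs]] Arr_sup_eq[OF ob(1-3,7-9) img[unfolded eqs]]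
      comp_join_right[OF ob(1,4,7) A(1) v(1)] comp_join_right[OF ob(2,5,8) A(2) v(2)]
    by (simp add: eqs image_image)
next
  fix p q r u B
  assume *: "p \<in> Ob (Arr Q)" "q \<in> Ob (Arr Q)" "r \<in> Ob (Arr Q)"
    "u \<in> Arrows (Arr Q) p q" "B \<subseteq> Arrows (Arr Q) q r"
  obtain X Y \<phi> X' Y' \<psi> X'' Y'' \<chi> \<zeta> \<eta> where eqs: "p = (X, Y, \<phi>)" "q = (X', Y', \<psi>)" "r = (X'', Y'', \<chi>)" "u = (\<zeta>, \<eta>)"
    by (metis prod.exhaust)
  have ob: "X \<in> Ob Q" "Y \<in> Ob Q" "\<phi> \<in> Arrows Q X Y" "X' \<in> Ob Q" "Y' \<in> Ob Q" "\<psi> \<in> Arrows Q X' Y'"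
    "X'' \<in> Ob Q" "Y'' \<in> Ob Q" "\<chi> \<in> Arrows Q X'' Y''"
    using *(1-3) by (simp_all add: eqs Arr_simps(1))
  let ?c = "\<lambda>v. Comp (Arr Q) p q r v u"
  have img: "?c ` B \<subseteq> Arrows (Arr Q) p r"
    using *(4,5) unfolding eqs by (auto intro!: Arr_comp_closed ob)
  have B: "fst ` B \<subseteq> Arrows Q X' X''" "snd ` B \<subseteq> Arrows Q Y' Y''"
    using *(5) by (auto simp: eqs Arr_simps)
  have u: "\<zeta> \<in> Arrows Q X X'" "\<eta> \<in> Arrows Q Y Y'" using *(4) by (auto simp: eqs Arr_simps)
  have "?c v = (Comp Q X X' X'' (fst v) \<zeta>, Comp Q Y Y' Y'' (snd v) \<eta>)" for v
    by (cases v) (simp add: eqs Arr_simps)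
  then show "?c (\<Squnion>\<^bsub>Hom (Arr Q) q r\<^esub> B) = \<Squnion>\<^bsub>Hom (Arr Q) p r\<^esub> (?c ` B)"
    using Arr_sup_eq[OF ob(4-9) *(5)[unfolded eqs]] Arr_sup_eq[OF ob(1-3,7-9) img[unfolded eqs]]
      comp_join_left[OF ob(1,4,7) u(1) B(1)] comp_join_left[OF ob(2,5,8) u(2) B(2)]
    by (simp add: eqs image_image)
qed

end


section \<open>Quantaloids faithful over another one\<close>

text \<open>The pattern of \<open>IntDist Q\<close> over \<open>QDist Q\<close>: arrows of
  \<open>A\<close> are arrows of \<open>B\<close> with an additional property that is stable under
  identities, composites and joins, while order, composition and identities are those of
  \<open>B\<close>. The map \<open>F\<close> may identify objects, since one
  \<open>Q\<close>-category carries many interior operators.\<close>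

locale quantaloid_over = B: quantaloid B
  for B :: "('p, 'm) quantaloid_struct" +
  fixes A :: "('o, 'm) quantaloid_struct" and F :: "'o \<Rightarrow> 'p"
  assumes map_ob: "p \<in> Ob A \<Longrightarrow> F p \<in> Ob B"
    and arrow_B: "\<lbrakk>p \<in> Ob A; q \<in> Ob A; u \<in> Arrows A p q\<rbrakk> \<Longrightarrow> u \<in> Arrows B (F p) (F q)"
    and eq_A: "(.=\<^bsub>Hom A p q\<^esub>) = (=)"
    and le_A: "u \<sqsubseteq>\<^bsub>Hom A p q\<^esub> v \<longleftrightarrow> u \<sqsubseteq>\<^bsub>Hom B (F p) (F q)\<^esub> v"
    and comp_A: "Comp A p q r = Comp B (F p) (F q) (F r)"
    and idt_A: "Idt A p = Idt B (F p)"
    and idt_closed_A: "p \<in> Ob A \<Longrightarrow> Idt B (F p) \<in> Arrows A p p"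
    and comp_closed_A: "\<lbrakk>p \<in> Ob A; q \<in> Ob A; r \<in> Ob A; u \<in> Arrows A p q; v \<in> Arrows A q r\<rbrakk>
      \<Longrightarrow> Comp B (F p) (F q) (F r) v u \<in> Arrows A p r"
    and sup_closed_A: "\<lbrakk>p \<in> Ob A; q \<in> Ob A; S \<subseteq> Arrows A p q\<rbrakk> \<Longrightarrow> \<Squnion>\<^bsub>Hom B (F p) (F q)\<^esub> S \<in> Arrows A p q"
begin

lemma arrows_B: "\<lbrakk>p \<in> Ob A; q \<in> Ob A; S \<subseteq> Arrows A p q\<rbrakk> \<Longrightarrow> S \<subseteq> Arrows B (F p) (F q)"
  using arrow_B by blast

lemma sup_le_iff_A:
  assumes "p \<in> Ob A" "q \<in> Ob A" "S \<subseteq> Arrows A p q" "w \<in> Arrows A p q"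
  shows "\<Squnion>\<^bsub>Hom B (F p) (F q)\<^esub> S \<sqsubseteq>\<^bsub>Hom A p q\<^esub> w \<longleftrightarrow> (\<forall>s\<in>S. s \<sqsubseteq>\<^bsub>Hom A p q\<^esub> w)"
  unfolding le_A using assms by (intro B.sup_le_iff map_ob arrow_B arrows_B)

lemma complete_lattice_A:
  assumes "p \<in> Ob A" "q \<in> Ob A"
  shows "complete_lattice (Hom A p q)"
proof (rule complete_lattice_supI)
  fix S assume S: "S \<subseteq> Arrows A p q"
  show "\<exists>s\<in>Arrows A p q. \<forall>w\<in>Arrows A p q. s \<sqsubseteq>\<^bsub>Hom A p q\<^esub> w \<longleftrightarrow> (\<forall>a\<in>S. a \<sqsubseteq>\<^bsub>Hom A p q\<^esub> w)"
    using sup_closed_A[OF assms S] sup_le_iff_A[OF assms S] by blast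
next
  fix u v w
  assume "u \<in> Arrows A p q" "v \<in> Arrows A p q" "w \<in> Arrows A p q"
    "u \<sqsubseteq>\<^bsub>Hom A p q\<^esub> v" "v \<sqsubseteq>\<^bsub>Hom A p q\<^esub> w"
  then show "u \<sqsubseteq>\<^bsub>Hom A p q\<^esub> w"
    unfolding le_A
    using B.arrow_trans[OF assms[THEN map_ob] arrow_B[OF assms] arrow_B[OF assms] arrow_B[OF assms], of u v w]
    by blast
next
  fix u v
  assume "u \<in> Arrows A p q" "v \<in> Arrows A p q" "u \<sqsubseteq>\<^bsub>Hom A p q\<^esub> v" "v \<sqsubseteq>\<^bsub>Hom A p q\<^esub> u"
  then show "u = v"
    unfolding le_A
    using B.arrow_antisym[OF assms[THEN map_ob] arrow_B[OF assms] arrow_B[OF assms], of u v]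
    by blast
qed (simp_all add: eq_A le_A B.arrow_refl map_ob arrow_B assms)

text \<open>The join formed in \<open>B\<close> stays in \<open>A\<close>, and its universal
  property there restricts to the arrows of \<open>A\<close>.\<close>

lemma sup_eq_A:
  assumes "p \<in> Ob A" "q \<in> Ob A" "S \<subseteq> Arrows A p q"
  shows "\<Squnion>\<^bsub>Hom A p q\<^esub> S = \<Squnion>\<^bsub>Hom B (F p) (F q)\<^esub> S"
  by (rule complete_lattice.sup_eqI[OF complete_lattice_A assms(3) sup_closed_A])
    (use assms sup_le_iff_A in auto)

lemma quantaloid_A: "quantaloid A"
proof (rule quantaloid.intro, unfold comp_A idt_A)
  fix p q r S v
  assume *: "p \<in> Ob A" "q \<in> Ob A" "r \<in> Ob A" "S \<subseteq> Arrows A p q" "v \<in> Arrows A q r"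
  have "Comp B (F p) (F q) (F r) v ` S \<subseteq> Arrows A p r"
    using * comp_closed_A by blast
  with * show "Comp B (F p) (F q) (F r) v (\<Squnion>\<^bsub>Hom A p q\<^esub> S) =
      \<Squnion>\<^bsub>Hom A p r\<^esub> (Comp B (F p) (F q) (F r) v ` S)"
    by (simp add: sup_eq_A B.comp_join_right map_ob arrow_B arrows_B)
next
  fix p q r u S
  assume *: "p \<in> Ob A" "q \<in> Ob A" "r \<in> Ob A" "u \<in> Arrows A p q" "S \<subseteq> Arrows A q r"
  have "(\<lambda>v. Comp B (F p) (F q) (F r) v u) ` S \<subseteq> Arrows A p r"
    using * comp_closed_A by blast
  with * show "Comp B (F p) (F q) (F r) (\<Squnion>\<^bsub>Hom A q r\<^esub> S) u =
      \<Squnion>\<^bsub>Hom A p r\<^esub> ((\<lambda>v. Comp B (F p) (F q) (F r) v u) ` S)"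
    by (simp add: sup_eq_A B.comp_join_left map_ob arrow_B arrows_B)
qed (simp_all add: complete_lattice_A idt_closed_A comp_closed_A B.comp_idt_left B.comp_idt_right
    B.comp_assoc map_ob arrow_B)

end


section \<open>Presheaves\<close>

context quantaloid
begin

lemma point_simps [simp]:
  "carrier (point Q q) = UNIV" "ty (point Q q) = (\<lambda>_. q)" "hm (point Q q) = (\<lambda>_ _. Idt Q q)"
  by (simp_all add: point_def)

lemma point_families: "(\<lambda>_ _. u) \<in> families Q (point Q q) (point Q r) \<longleftrightarrow> u \<in> Arrows Q q r"
  by (auto simp: families_def)

lemma qcategory_point: "q \<in> Ob Q \<Longrightarrow> qcategory Q (point Q q)"
  using idt_closed[of q] arrow_refl[of q q "Idt Q q"] comp_idt_left[of q q "Idt Q q"]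
  by (simp add: qcategory_def point_families) auto

text \<open>The hom-arrow of a one-object category is the identity itself, not merely above it, so
  every family into a point satisfies the left unit law. For presheaves the action of
  \<open>X\<close> is thus the only condition with content.\<close>

lemma dist_comp_point:
  assumes X: "qcategory Q X" and q: "q \<in> Ob Q" and \<mu>: "\<mu> \<in> families Q X (point Q q)"
  shows "dist_comp Q X (point Q q) (point Q q) (\<lambda>_ _. Idt Q q) \<mu> = \<mu>"
proof -
  note P = qcategory_point[OF q]
  have I: "(\<lambda>_ _. Idt Q q) \<in> families Q (point Q q) (point Q q)"
    by (simp add: point_families idt_closed q)
  have "dist_le Q X (point Q q) (dist_comp Q X (point Q q) (point Q q) (\<lambda>_ _. Idt Q q) \<mu>) \<mu>"
    unfolding dist_comp_le_iff[OF X P P \<mu> I \<mu>]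
    using \<mu>[THEN families_arrow] q by (simp add: comp_idt_left qcategory_ty[OF X] arrow_refl)
  then show ?thesis
    using comp_hm_le(2)[OF X P \<mu>] dist_comp_families[OF X P P \<mu> I] \<mu>
    by (intro dist_le_antisym[OF X P]) simp_all
qed

lemma presheaves_iff:
  "m \<in> presheaves Q X \<longleftrightarrow> fst m \<in> Ob Q \<and> distributor Q X (point Q (fst m)) (snd m)"
  by (simp add: presheaves_def case_prod_beta)

lemma presheaf_families: "m \<in> presheaves Q X \<Longrightarrow> snd m \<in> families Q X (point Q (fst m))"
  by (simp add: presheaves_iff distributor_families)

lemma presheaf_point: "m \<in> presheaves Q X \<Longrightarrow> qcategory Q (point Q (fst m))"
  by (simp add: presheaves_iff qcategory_point)

lemma PSh_simps:
  "carrier (PSh Q X) = presheaves Q X"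
  "m \<in> presheaves Q X \<Longrightarrow> ty (PSh Q X) m = fst m"
  by (simp_all add: PSh_def)

text \<open>The transpose of \<open>u \<le> hm (PSh Q X) m m'\<close>, namely
  \<open>u \<circ> m \<le> m'\<close>, with the arrow \<open>u\<close> regarded as a family between
  points. Residuals are avoided in this form.\<close>

definition presheaf_le ::
  "('a, 'o, 'm) qcat \<Rightarrow> 'm \<Rightarrow> ('a, 'o, 'm) presheaf \<Rightarrow> ('a, 'o, 'm) presheaf \<Rightarrow> bool" where
  "presheaf_le X u m m' \<longleftrightarrow> dist_le Q X (point Q (fst m'))
    (dist_comp Q X (point Q (fst m)) (point Q (fst m')) (\<lambda>_ _. u) (snd m)) (snd m')"

lemma hm_PSh:
  assumes X: "qcategory Q X" and m: "m \<in> presheaves Q X" and m': "m' \<in> presheaves Q X"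
  shows "hm (PSh Q X) m m' \<in> Arrows Q (fst m) (fst m')"
    and "u \<in> Arrows Q (fst m) (fst m') \<Longrightarrow>
      u \<sqsubseteq>\<^bsub>Hom Q (fst m) (fst m')\<^esub> hm (PSh Q X) m m' \<longleftrightarrow> presheaf_le X u m m'"
proof -
  let ?r = "dist_residual Q X (point Q (fst m)) (point Q (fst m')) (snd m') (snd m)"
  note P = presheaf_point[OF m] presheaf_point[OF m'] and f = presheaf_families[OF m] presheaf_families[OF m']
  have hm: "hm (PSh Q X) m m' = ?r () ()"
    using m m' by (simp add: PSh_def)
  have "?r \<in> families Q (point Q (fst m)) (point Q (fst m'))"
    by (rule dist_residual_families[OF X P f])
  from families_arrow[OF this, of "()" "()"] show "hm (PSh Q X) m m' \<in> Arrows Q (fst m) (fst m')"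
    by (simp add: hm)
  assume "u \<in> Arrows Q (fst m) (fst m')"
  then have "(\<lambda>_ _. u) \<in> families Q (point Q (fst m)) (point Q (fst m'))"
    by (simp add: point_families)
  from le_dist_residual_iff[OF X P f this]
  show "u \<sqsubseteq>\<^bsub>Hom Q (fst m) (fst m')\<^esub> hm (PSh Q X) m m' \<longleftrightarrow> presheaf_le X u m m'"
    by (simp add: hm presheaf_le_def dist_le_def)
qed

lemma presheaf_le_idt:
  assumes X: "qcategory Q X" and m: "m \<in> presheaves Q X" and eq: "fst m = fst m'"
  shows "presheaf_le X (Idt Q (fst m)) m m' \<longleftrightarrow> dist_le Q X (point Q (fst m)) (snd m) (snd m')"
  using dist_comp_point[OF X _ presheaf_families[OF m]] m eq
  by (simp add: presheaf_le_def presheaves_iff)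

text \<open>The transposed inequality at the identity arrow: \<open>1 \<circ> m \<le> m'\<close> is
  the entrywise order.\<close>

lemma under_le_PSh_iff:
  assumes X: "qcategory Q X" and m: "m \<in> presheaves Q X" and m': "m' \<in> presheaves Q X"
  shows "under_le Q (PSh Q X) m m' \<longleftrightarrow>
    fst m = fst m' \<and> dist_le Q X (point Q (fst m)) (snd m) (snd m')"
proof (cases "fst m = fst m'")
  case True
  have "Idt Q (fst m) \<in> Arrows Q (fst m) (fst m')"
    using m True by (simp add: presheaves_iff idt_closed)
  from hm_PSh(2)[OF X m m' this] show ?thesis
    using True presheaf_le_idt[OF X m True] m m' by (simp add: under_le_def PSh_simps)
qed (use m m' in \<open>simp add: under_le_def PSh_simps\<close>)

text \<open>Comparing two hom-arrows is the same as comparing the arrows \<open>u\<close> below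
  them. After transposition, functoriality says that \<open>u \<circ> m \<le> m'\<close> implies
  \<open>u \<circ> f m \<le> f m'\<close>, which can be checked by calculating with
  composites.\<close>

lemma qfunctor_PSh_iff:
  assumes X: "qcategory Q X" and Y: "qcategory Q Y"
  shows "qfunctor Q (PSh Q X) (PSh Q Y) f \<longleftrightarrow>
    f \<in> presheaves Q X \<rightarrow>\<^sub>E presheaves Q Y \<and>
    (\<forall>m \<in> presheaves Q X. fst (f m) = fst m) \<and>
    (\<forall>m \<in> presheaves Q X. \<forall>m' \<in> presheaves Q X. \<forall>u \<in> Arrows Q (fst m) (fst m').
      presheaf_le X u m m' \<longrightarrow> presheaf_le Y u (f m) (f m'))"
proof (cases "f \<in> presheaves Q X \<rightarrow>\<^sub>E presheaves Q Y \<and> (\<forall>m \<in> presheaves Q X. fst (f m) = fst m)")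
  case True
  then have f: "f m \<in> presheaves Q Y" "fst (f m) = fst m" if "m \<in> presheaves Q X" for m
    using that by auto
  have "hm (PSh Q X) m m' \<sqsubseteq>\<^bsub>Hom Q (fst m) (fst m')\<^esub> hm (PSh Q Y) (f m) (f m') \<longleftrightarrow>
      (\<forall>u \<in> Arrows Q (fst m) (fst m'). presheaf_le X u m m' \<longrightarrow> presheaf_le Y u (f m) (f m'))"
    (is "?h \<sqsubseteq>\<^bsub>?H\<^esub> ?k \<longleftrightarrow> _")
    if m: "m \<in> presheaves Q X" and m': "m' \<in> presheaves Q X" for m m'
  proof -
    have ob: "fst m \<in> Ob Q" "fst m' \<in> Ob Q" using m m' by (simp_all add: presheaves_iff)
    have h: "?h \<in> carrier ?H" and k: "?k \<in> carrier ?H"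
      using hm_PSh(1)[OF X m m'] hm_PSh(1)[OF Y f(1)[OF m] f(1)[OF m']] f(2)[OF m] f(2)[OF m'] by simp_all
    have "?h \<sqsubseteq>\<^bsub>?H\<^esub> ?k \<longleftrightarrow> (\<forall>u \<in> carrier ?H. u \<sqsubseteq>\<^bsub>?H\<^esub> ?h \<longrightarrow> u \<sqsubseteq>\<^bsub>?H\<^esub> ?k)"
      using h k arrow_refl[OF ob h] arrow_trans[OF ob _ h k] by blast
    then show ?thesis
      using hm_PSh(2)[OF X m m'] hm_PSh(2)[OF Y f(1)[OF m] f(1)[OF m']] f(2)[OF m] f(2)[OF m'] by simp
  qed
  with True show ?thesis by (simp add: qfunctor_def PSh_simps f)
qed (auto simp: qfunctor_def PSh_simps PiE_iff)

lemma qfunctor_PSh_mono: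
  assumes X: "qcategory Q X" and Y: "qcategory Q Y" and f: "qfunctor Q (PSh Q X) (PSh Q Y) f"
    and m: "m \<in> presheaves Q X" and m': "m' \<in> presheaves Q X" and eq: "fst m = fst m'"
    and le: "dist_le Q X (point Q (fst m)) (snd m) (snd m')"
  shows "dist_le Q Y (point Q (fst m)) (snd (f m)) (snd (f m'))"
proof -
  have fm: "f m \<in> presheaves Q Y" "fst (f m) = fst m" "fst (f m') = fst m'"
    using f m m' unfolding qfunctor_PSh_iff[OF X Y] by auto
  have "Idt Q (fst m) \<in> Arrows Q (fst m) (fst m')"
    using m eq by (simp add: presheaves_iff idt_closed)
  moreover have "presheaf_le X (Idt Q (fst m)) m m'"
    using le by (simp add: presheaf_le_idt[OF X m eq])
  ultimately have "presheaf_le Y (Idt Q (fst (f m))) (f m) (f m')"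
    using f m m' fm unfolding qfunctor_PSh_iff[OF X Y] by auto
  then show ?thesis
    using presheaf_le_idt[OF Y fm(1), of "f m'"] fm eq by simp
qed

lemma qfunctor_PSh_compose:
  assumes X: "qcategory Q X" and Y: "qcategory Q Y" and Z: "qcategory Q Z"
    and f: "qfunctor Q (PSh Q X) (PSh Q Y) f" and g: "qfunctor Q (PSh Q Y) (PSh Q Z) g"
  shows "qfunctor Q (PSh Q X) (PSh Q Z) (compose (carrier (PSh Q X)) g f)"
  unfolding qfunctor_PSh_iff[OF X Z] PSh_simps
proof (intro conjI ballI impI)
  note f' = f[unfolded qfunctor_PSh_iff[OF X Y]] and g' = g[unfolded qfunctor_PSh_iff[OF Y Z]]
  have fm: "f m \<in> presheaves Q Y" "fst (f m) = fst m" if "m \<in> presheaves Q X" for m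
    using f' that by auto
  show "compose (presheaves Q X) g f \<in> presheaves Q X \<rightarrow>\<^sub>E presheaves Q Z"
    using fm g' by (auto simp: compose_def)
  show "fst (compose (presheaves Q X) g f m) = fst m" if "m \<in> presheaves Q X" for m
    using fm g' that by (simp add: compose_def)
  show "presheaf_le Z u (compose (presheaves Q X) g f m) (compose (presheaves Q X) g f m')"
    if "m \<in> presheaves Q X" "m' \<in> presheaves Q X" "u \<in> Arrows Q (fst m) (fst m')" "presheaf_le X u m m'"
    for m m' u
    using fm f' g' that by (simp add: compose_def)
qed

section \<open>The two Kan functors on presheaves\<close>

lemma kan_upper_simps:
  assumes "l \<in> presheaves Q Y"
  shows "fst (kan_upper Q X Y \<phi> l) = fst l"
    and "snd (kan_upper Q X Y \<phi> l) = dist_comp Q X Y (point Q (fst l)) (snd l) \<phi>"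
  using assms by (simp_all add: kan_upper_def PSh_simps)

lemma kan_lower_simps:
  assumes "m \<in> presheaves Q X"
  shows "fst (kan_lower Q X Y \<phi> m) = fst m"
    and "snd (kan_lower Q X Y \<phi> m) = dist_residual Q X Y (point Q (fst m)) (snd m) \<phi>"
  using assms by (simp_all add: kan_lower_def PSh_simps)

lemma kan_upper_presheaf:
  assumes "qcategory Q X" "qcategory Q Y" "distributor Q X Y \<phi>" "l \<in> presheaves Q Y"
  shows "kan_upper Q X Y \<phi> l \<in> presheaves Q X"
  using assms by (simp add: presheaves_iff kan_upper_simps distributor_dist_comp qcategory_point)

lemma kan_lower_presheaf:
  assumes "qcategory Q X" "qcategory Q Y" "distributor Q X Y \<phi>" "m \<in> presheaves Q X"
  shows "kan_lower Q X Y \<phi> m \<in> presheaves Q Y"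
  using assms by (simp add: presheaves_iff kan_lower_simps distributor_dist_residual qcategory_point)

text \<open>From \<open>u \<circ> m \<le> m'\<close> one gets
  \<open>u \<circ> (m \<circ> \<phi>) \<le> m' \<circ> \<phi>\<close> by composing with
  \<open>\<phi>\<close> and rebracketing.\<close>

lemma qfunctor_kan_upper:
  assumes X: "qcategory Q X" and Y: "qcategory Q Y" and \<phi>: "distributor Q X Y \<phi>"
  shows "qfunctor Q (PSh Q Y) (PSh Q X) (kan_upper Q X Y \<phi>)"
  unfolding qfunctor_PSh_iff[OF Y X]
proof (intro conjI ballI impI)
  show "kan_upper Q X Y \<phi> \<in> presheaves Q Y \<rightarrow>\<^sub>E presheaves Q X"
    using kan_upper_presheaf[OF X Y \<phi>] by (auto simp: kan_upper_def PSh_simps)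
next
  note \<phi>' = distributor_families[OF \<phi>]
  fix m m' u
  assume m: "m \<in> presheaves Q Y" and m': "m' \<in> presheaves Q Y" and "u \<in> Arrows Q (fst m) (fst m')"
    and "presheaf_le Y u m m'"
  then have u: "(\<lambda>_ _. u) \<in> families Q (point Q (fst m)) (point Q (fst m'))"
    and le: "dist_le Q Y (point Q (fst m')) (dist_comp Q Y (point Q (fst m)) (point Q (fst m')) (\<lambda>_ _. u) (snd m)) (snd m')"
    by (simp_all add: point_families presheaf_le_def)
  note P = presheaf_point[OF m] presheaf_point[OF m'] and f = presheaf_families[OF m] presheaf_families[OF m']
  have "dist_le Q X (point Q (fst m'))
      (dist_comp Q X Y (point Q (fst m')) (dist_comp Q Y (point Q (fst m)) (point Q (fst m')) (\<lambda>_ _. u) (snd m)) \<phi>)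
      (dist_comp Q X Y (point Q (fst m')) (snd m') \<phi>)"
    by (intro dist_comp_mono dist_le_refl dist_comp_families X Y P \<phi>' f u le)
  then show "presheaf_le X u (kan_upper Q X Y \<phi> m) (kan_upper Q X Y \<phi> m')"
    by (simp add: presheaf_le_def kan_upper_simps m m' dist_comp_assoc[OF X Y P \<phi>' f(1) u])
qed (simp add: kan_upper_simps)

text \<open>The claim \<open>u \<circ> (m \<swarrow> \<phi>) \<le> m' \<swarrow> \<phi>\<close>
  transposes to \<open>u \<circ> (m \<swarrow> \<phi>) \<circ> \<phi> \<le> m'\<close>, and the left
  side lies below \<open>u \<circ> m\<close>.\<close>

lemma qfunctor_kan_lower:
  assumes X: "qcategory Q X" and Y: "qcategory Q Y" and \<phi>: "distributor Q X Y \<phi>"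
  shows "qfunctor Q (PSh Q X) (PSh Q Y) (kan_lower Q X Y \<phi>)"
  unfolding qfunctor_PSh_iff[OF X Y]
proof (intro conjI ballI impI)
  show "kan_lower Q X Y \<phi> \<in> presheaves Q X \<rightarrow>\<^sub>E presheaves Q Y"
    using kan_lower_presheaf[OF X Y \<phi>] by (auto simp: kan_lower_def PSh_simps)
next
  note \<phi>' = distributor_families[OF \<phi>]
  fix m m' u
  assume m: "m \<in> presheaves Q X" and m': "m' \<in> presheaves Q X" and "u \<in> Arrows Q (fst m) (fst m')"
    and "presheaf_le X u m m'"
  then have u: "(\<lambda>_ _. u) \<in> families Q (point Q (fst m)) (point Q (fst m'))"
    and le: "dist_le Q X (point Q (fst m')) (dist_comp Q X (point Q (fst m)) (point Q (fst m')) (\<lambda>_ _. u) (snd m)) (snd m')"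
    by (simp_all add: point_families presheaf_le_def)
  note P = presheaf_point[OF m] presheaf_point[OF m'] and f = presheaf_families[OF m] presheaf_families[OF m']
  let ?r = "dist_residual Q X Y (point Q (fst m)) (snd m) \<phi>"
  have r: "?r \<in> families Q Y (point Q (fst m))" by (rule dist_residual_families[OF X Y P(1) \<phi>' f(1)])
  have r\<phi>: "dist_comp Q X Y (point Q (fst m)) ?r \<phi> \<in> families Q X (point Q (fst m))"
    by (rule dist_comp_families[OF X Y P(1) \<phi>' r])
  have "dist_le Q X (point Q (fst m'))
      (dist_comp Q X (point Q (fst m)) (point Q (fst m')) (\<lambda>_ _. u) (dist_comp Q X Y (point Q (fst m)) ?r \<phi>))
      (dist_comp Q X (point Q (fst m)) (point Q (fst m')) (\<lambda>_ _. u) (snd m))"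
    by (intro dist_comp_mono dist_le_refl dist_residual_comp_le X Y P \<phi>' f u r\<phi>)
  from dist_le_trans[OF X P(2) dist_comp_families[OF X P r\<phi> u] dist_comp_families[OF X P f(1) u] f(2) this le]
  have "dist_le Q Y (point Q (fst m'))
     (dist_comp Q Y (point Q (fst m)) (point Q (fst m')) (\<lambda>_ _. u) ?r)
     (dist_residual Q X Y (point Q (fst m')) (snd m') \<phi>)"
    unfolding le_dist_residual_iff[OF X Y P(2) \<phi>' f(2) dist_comp_families[OF Y P r u]]
    by (simp add: dist_comp_assoc[OF X Y P \<phi>' r u])
  then show "presheaf_le Y u (kan_lower Q X Y \<phi> m) (kan_lower Q X Y \<phi> m')"
    by (simp add: presheaf_le_def kan_lower_simps m m')
qed (simp add: kan_lower_simps)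


section \<open>The quantaloid of interior spaces\<close>

lemma interior_space_iff:
  "interior_space Q (X, a) \<longleftrightarrow> qcategory Q X \<and> qfunctor Q (PSh Q X) (PSh Q X) a \<and>
    (\<forall>m \<in> presheaves Q X. dist_le Q X (point Q (fst m)) (snd (a m)) (snd m)) \<and>
    (\<forall>m \<in> presheaves Q X. a (a m) = a m)"
proof (cases "qcategory Q X \<and> qfunctor Q (PSh Q X) (PSh Q X) a")
  case True
  then have X: "qcategory Q X" and a: "a \<in> presheaves Q X \<rightarrow>\<^sub>E presheaves Q X"
    "\<And>m. m \<in> presheaves Q X \<Longrightarrow> a m \<in> presheaves Q X \<and> fst (a m) = fst m"
    by (auto simp: qfunctor_PSh_iff)
  have "compose (presheaves Q X) a a = a \<longleftrightarrow> (\<forall>m \<in> presheaves Q X. a (a m) = a m)"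
  proof
    assume "compose (presheaves Q X) a a = a"
    then show "\<forall>m \<in> presheaves Q X. a (a m) = a m" by (metis compose_eq)
  next
    assume "\<forall>m \<in> presheaves Q X. a (a m) = a m"
    then show "compose (presheaves Q X) a a = a"
      \<comment> \<open>Idempotence is an equation of functions; both sides are undefined off the
        presheaves, so agreement on presheaves is enough.\<close>
      using a(1) by (intro extensionalityI[of _ "presheaves Q X"]) (simp_all add: compose_eq PiE_def)
  qed
  with True a(2) show ?thesis
    by (auto simp: interior_space_def qfunctor_le_def PSh_simps under_le_PSh_iff[OF X])
qed (auto simp: interior_space_def)

lemma interior_presheaf:
  assumes "interior_space Q (X, a)" "m \<in> presheaves Q X"
  shows "a m \<in> presheaves Q X" "fst (a m) = fst m"
  using assms by (auto simp: interior_space_iff qfunctor_PSh_iff)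

text \<open>All maps involved preserve types, so the order of functors reduces to an entrywise
  inequality at each presheaf.\<close>

lemma continuous_dist_iff:
  assumes a: "interior_space Q (X, a)" and b: "interior_space Q (Y, b)"
  shows "continuous_dist Q (X, a) (Y, b) \<zeta> \<longleftrightarrow> distributor Q X Y \<zeta> \<and>
    (\<forall>l \<in> presheaves Q Y. dist_le Q X (point Q (fst l))
      (dist_comp Q X Y (point Q (fst l)) (snd (b l)) \<zeta>) (snd (a (kan_upper Q X Y \<zeta> l))))"
proof (cases "distributor Q X Y \<zeta>")
  case \<zeta>: True
  have X: "qcategory Q X" and Y: "qcategory Q Y" using a b by (simp_all add: interior_space_iff)
  show ?thesis
    using \<zeta> interior_presheaf[OF a] interior_presheaf[OF b] kan_upper_presheaf[OF X Y \<zeta>]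
    by (auto simp: continuous_dist_def qfunctor_le_def PSh_simps compose_def under_le_PSh_iff[OF X]
        kan_upper_simps)
qed (simp add: continuous_dist_def)

lemma continuous_distD:
  assumes "continuous_dist Q (X, a) (Y, b) \<zeta>" "interior_space Q (X, a)" "interior_space Q (Y, b)"
    "l \<in> presheaves Q Y"
  shows "dist_le Q X (point Q (fst l))
      (dist_comp Q X Y (point Q (fst l)) (snd (b l)) \<zeta>) (snd (a (kan_upper Q X Y \<zeta> l)))"
  using assms by (simp add: continuous_dist_iff)

lemma continuous_dist_hm:
  assumes a: "interior_space Q (X, a)"
  shows "continuous_dist Q (X, a) (X, a) (hm X)"
proof -
  have X: "qcategory Q X" using a by (simp add: interior_space_iff)
  have "dist_comp Q X X (point Q (fst m)) (snd m) (hm X) = snd m" if "m \<in> presheaves Q X" for m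
    using that dist_comp_hm_right[OF X presheaf_point[OF that]] by (simp add: presheaves_iff)
  note id = this interior_presheaf[OF a]
  have "kan_upper Q X X (hm X) l = l" if "l \<in> presheaves Q X" for l
    using that by (intro prod_eqI) (simp_all add: kan_upper_simps id)
  moreover have "dist_le Q X (point Q (fst l)) (dist_comp Q X X (point Q (fst l)) (snd (a l)) (hm X)) (snd (a l))"
    if "l \<in> presheaves Q X" for l
    using dist_le_refl[OF X] id(1)[OF id(2)[OF that]] id(2,3)[OF that] presheaf_point[OF that]
      presheaf_families[OF id(2)[OF that]]
    by simp
  ultimately show ?thesis
    by (simp add: continuous_dist_iff[OF a a] distributor_hm X)
qed

text \<open>For a presheaf \<open>l\<close> the chain is \<open>c l \<circ> \<eta> \<circ> \<zeta>
  \<le> b (l \<circ> \<eta>) \<circ> \<zeta> \<le> a (l \<circ> \<eta> \<circ> \<zeta>)\<close>: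
  continuity of \<open>\<eta>\<close> at \<open>l\<close>, then of \<open>\<zeta>\<close> at
  \<open>l \<circ> \<eta>\<close>.\<close>

lemma continuous_dist_comp:
  assumes a: "interior_space Q (X, a)" and b: "interior_space Q (Y, b)" and c: "interior_space Q (Z, c)"
    and \<zeta>: "continuous_dist Q (X, a) (Y, b) \<zeta>" and \<eta>: "continuous_dist Q (Y, b) (Z, c) \<eta>"
  shows "continuous_dist Q (X, a) (Z, c) (dist_comp Q X Y Z \<eta> \<zeta>)"
proof -
  have X: "qcategory Q X" and Y: "qcategory Q Y" and Z: "qcategory Q Z"
    using a b c by (simp_all add: interior_space_iff)
  have d: "distributor Q X Y \<zeta>" "distributor Q Y Z \<eta>"
    using \<zeta> \<eta> by (simp_all add: continuous_dist_def)
  note f = d[THEN distributor_families]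
  have "dist_le Q X (point Q (fst l))
      (dist_comp Q X Z (point Q (fst l)) (snd (c l)) (dist_comp Q X Y Z \<eta> \<zeta>))
      (snd (a (kan_upper Q X Z (dist_comp Q X Y Z \<eta> \<zeta>) l)))"
    if l: "l \<in> presheaves Q Z" for l
  proof -
    let ?P = "point Q (fst l)" and ?l' = "kan_upper Q Y Z \<eta> l"
    note P = presheaf_point[OF l]
    have l': "?l' \<in> presheaves Q Y" "fst ?l' = fst l"
      using kan_upper_presheaf[OF Y Z d(2) l] by (simp_all add: kan_upper_simps l)
    have al': "a (kan_upper Q X Y \<zeta> ?l') \<in> presheaves Q X" "fst (a (kan_upper Q X Y \<zeta> ?l')) = fst l"
      using interior_presheaf[OF a kan_upper_presheaf[OF X Y d(1) l'(1)]] l' by (simp_all add: kan_upper_simps)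
    have cl: "snd (c l) \<in> families Q Z ?P" and bl: "snd (b ?l') \<in> families Q Y ?P"
      using presheaf_families[OF interior_presheaf(1)[OF c l]] interior_presheaf(2)[OF c l]
        presheaf_families[OF interior_presheaf(1)[OF b l'(1)]] interior_presheaf(2)[OF b l'(1)] l'(2)
      by simp_all
    have *: "dist_comp Q Y Z ?P (snd (c l)) \<eta> \<in> families Q Y ?P"
      by (rule dist_comp_families[OF Y Z P f(2) cl])
    have "dist_le Q X ?P (dist_comp Q X Y ?P (dist_comp Q Y Z ?P (snd (c l)) \<eta>) \<zeta>)
        (dist_comp Q X Y ?P (snd (b ?l')) \<zeta>)"
      by (intro dist_comp_mono dist_le_refl X Y P f * bl continuous_distD[OF \<eta> b c l])
    moreover have "dist_le Q X ?P (dist_comp Q X Y ?P (snd (b ?l')) \<zeta>) (snd (a (kan_upper Q X Y \<zeta> ?l')))"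
      using continuous_distD[OF \<zeta> a b l'(1)] l'(2) by simp
    moreover have "snd (a (kan_upper Q X Y \<zeta> ?l')) \<in> families Q X ?P"
      using presheaf_families[OF al'(1)] al'(2) by simp
    ultimately have "dist_le Q X ?P (dist_comp Q X Y ?P (dist_comp Q Y Z ?P (snd (c l)) \<eta>) \<zeta>)
        (snd (a (kan_upper Q X Y \<zeta> ?l')))"
      using dist_le_trans[OF X P dist_comp_families[OF X Y P f(1) *] dist_comp_families[OF X Y P f(1) bl]]
      by blast
    moreover have "kan_upper Q X Y \<zeta> ?l' = kan_upper Q X Z (dist_comp Q X Y Z \<eta> \<zeta>) l"
      by (intro prod_eqI)
        (simp_all add: kan_upper_simps l l' dist_comp_assoc[OF X Y Z P f presheaf_families[OF l]])
    ultimately show ?thesis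
      by (simp add: dist_comp_assoc[OF X Y Z P f cl])
  qed
  then show ?thesis
    by (simp add: continuous_dist_iff[OF a c] distributor_dist_comp[OF X Y Z d])
qed

text \<open>For each \<open>\<zeta>\<close> in \<open>S\<close>, \<open>b l \<circ> \<zeta> \<le> a
  (l \<circ> \<zeta>) \<le> a (l \<circ> \<Squnion>S)\<close>, where the second inequality is
  monotonicity of \<open>a\<close>. The join over \<open>S\<close> then only has to be taken on the
  left.\<close>

lemma continuous_dist_sup:
  assumes a: "interior_space Q (X, a)" and b: "interior_space Q (Y, b)"
    and S: "\<And>\<zeta>. \<zeta> \<in> S \<Longrightarrow> continuous_dist Q (X, a) (Y, b) \<zeta>"
  shows "continuous_dist Q (X, a) (Y, b) (dist_sup X Y S)"
proof -
  have X: "qcategory Q X" and Y: "qcategory Q Y"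
    using a b by (simp_all add: interior_space_iff)
  have d: "\<And>\<zeta>. \<zeta> \<in> S \<Longrightarrow> distributor Q X Y \<zeta>"
    using S by (simp add: continuous_dist_def)
  then have f: "S \<subseteq> families Q X Y" by (auto intro: distributor_families)
  note sup = distributor_dist_sup[OF X Y d]
  have "dist_le Q X (point Q (fst l)) (dist_comp Q X Y (point Q (fst l)) (snd (b l)) (dist_sup X Y S))
      (snd (a (kan_upper Q X Y (dist_sup X Y S) l)))"
    if l: "l \<in> presheaves Q Y" for l
  proof -
    let ?P = "point Q (fst l)" and ?k = "kan_upper Q X Y (dist_sup X Y S) l"
    note P = presheaf_point[OF l]
    have bl: "snd (b l) \<in> families Q Y ?P"
      using presheaf_families[OF interior_presheaf(1)[OF b l]] interior_presheaf(2)[OF b l] by simp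
    have k: "?k \<in> presheaves Q X" by (rule kan_upper_presheaf[OF X Y sup l])
    have ak: "snd (a ?k) \<in> families Q X ?P"
      using presheaf_families[OF interior_presheaf(1)[OF a k]] interior_presheaf(2)[OF a k]
      by (simp add: kan_upper_simps l)
    have "dist_le Q X ?P (dist_comp Q X Y ?P (snd (b l)) \<zeta>) (snd (a ?k))" if "\<zeta> \<in> S" for \<zeta>
    proof (rule dist_le_trans[OF X P _ _ ak])
      note \<zeta> = d[OF that]
      have z: "kan_upper Q X Y \<zeta> l \<in> presheaves Q X" by (rule kan_upper_presheaf[OF X Y \<zeta> l])
      show "dist_comp Q X Y ?P (snd (b l)) \<zeta> \<in> families Q X ?P"
        by (rule dist_comp_families[OF X Y P distributor_families[OF \<zeta>] bl])
      show "snd (a (kan_upper Q X Y \<zeta> l)) \<in> families Q X ?P"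
        using presheaf_families[OF interior_presheaf(1)[OF a z]] interior_presheaf(2)[OF a z]
        by (simp add: kan_upper_simps l)
      show "dist_le Q X ?P (dist_comp Q X Y ?P (snd (b l)) \<zeta>) (snd (a (kan_upper Q X Y \<zeta> l)))"
        by (rule continuous_distD[OF S[OF that] a b l])
      have "dist_le Q X ?P (snd (kan_upper Q X Y \<zeta> l)) (snd ?k)"
        unfolding kan_upper_simps[OF l]
        by (intro dist_comp_mono dist_le_refl X Y P distributor_families[OF \<zeta>] distributor_families[OF sup]
            presheaf_families[OF l] le_dist_sup f that)
      then show "dist_le Q X ?P (snd (a (kan_upper Q X Y \<zeta> l))) (snd (a ?k))"
        using qfunctor_PSh_mono[OF X X _ z k] a by (simp add: interior_space_iff kan_upper_simps l)
    qed
    then show ?thesis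
      by (simp add: comp_dist_sup_right_le_iff[OF X Y P f bl ak])
  qed
  then show ?thesis
    by (simp add: continuous_dist_iff[OF a b] sup)
qed

lemma IntDist_simps:
  "Ob (IntDist Q) = {S. interior_space Q S}"
  "Arrows (IntDist Q) S T = {\<zeta>. continuous_dist Q S T \<zeta>}"
  "\<zeta> \<sqsubseteq>\<^bsub>Hom (IntDist Q) S T\<^esub> \<eta> \<longleftrightarrow> dist_le Q (fst S) (fst T) \<zeta> \<eta>"
  "Comp (IntDist Q) S T U = dist_comp Q (fst S) (fst T) (fst U)"
  "Idt (IntDist Q) S = hm (fst S)"
  by (simp_all add: IntDist_def)

theorem quantaloid_over_IntDist:
  "quantaloid_over (QDist Q) (IntDist Q :: (('a, 'o, 'm) ispace, 'a \<Rightarrow> 'a \<Rightarrow> 'm) quantaloid_struct) fst"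
proof (intro quantaloid_over.intro quantaloid_QDist quantaloid_over_axioms.intro,
    unfold IntDist_simps QDist_simps mem_Collect_eq)
  fix p assume p: "interior_space Q p"
  then show "qcategory Q (fst p)" by (cases p) (simp add: interior_space_iff)
  show "continuous_dist Q p p (hm (fst p))" using p by (cases p) (simp add: continuous_dist_hm)
next
  fix p q :: "('a, 'o, 'm) ispace" and u
  assume "continuous_dist Q p q u"
  then show "distributor Q (fst p) (fst q) u"
    by (cases p; cases q) (simp add: continuous_dist_def)
next
  fix p q r :: "('a, 'o, 'm) ispace" and u v
  assume "interior_space Q p" "interior_space Q q" "interior_space Q r"
    "continuous_dist Q p q u" "continuous_dist Q q r v"
  then show "continuous_dist Q p r (dist_comp Q (fst p) (fst q) (fst r) v u)"
    by (cases p; cases q; cases r) (simp add: continuous_dist_comp)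
next
  fix p q :: "('a, 'o, 'm) ispace" and S
  assume p: "interior_space Q p" and q: "interior_space Q q"
    and "S \<subseteq> {\<zeta>. continuous_dist Q p q \<zeta>}"
  then have S: "\<And>\<zeta>. \<zeta> \<in> S \<Longrightarrow> continuous_dist Q (fst p, snd p) (fst q, snd q) \<zeta>"
    by auto
  then have "\<And>\<zeta>. \<zeta> \<in> S \<Longrightarrow> distributor Q (fst p) (fst q) \<zeta>"
    by (simp add: continuous_dist_def case_prod_beta)
  moreover have "continuous_dist Q (fst p, snd p) (fst q, snd q) (dist_sup (fst p) (fst q) S)"
    using p q S by (intro continuous_dist_sup) simp_all
  moreover have "qcategory Q (fst p)" "qcategory Q (fst q)"
    using p q by (cases p; cases q; simp add: interior_space_iff)+
  ultimately show "continuous_dist Q p q (\<Squnion>\<^bsub>Hom (QDist Q) (fst p) (fst q)\<^esub> S)"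
    by (simp add: QDist_sup_eq)
qed (simp_all add: IntDist_def)


section \<open>Interior operators induced by distributors\<close>

text \<open>A triangle identity of the adjunction between \<open>- \<circ> \<phi>\<close> and
  \<open>- \<swarrow> \<phi>\<close>: whatever factors through \<open>\<phi>\<close> is recovered
  from its residual. It yields idempotence of the interior operator and, later, the fixed
  columns.\<close>

lemma dist_comp_residual_comp:
  assumes X: "qcategory Q X" and Y: "qcategory Q Y" and Z: "qcategory Q Z"
    and \<phi>: "\<phi> \<in> families Q X Y" and \<psi>: "\<psi> \<in> families Q Y Z"
  shows "dist_comp Q X Y Z (dist_residual Q X Y Z (dist_comp Q X Y Z \<psi> \<phi>) \<phi>) \<phi> = dist_comp Q X Y Z \<psi> \<phi>"
proof -
  let ?\<xi> = "dist_comp Q X Y Z \<psi> \<phi>"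
  let ?r = "dist_residual Q X Y Z ?\<xi> \<phi>"
  note \<xi> = dist_comp_families[OF X Y Z \<phi> \<psi>]
  note r = dist_residual_families[OF X Y Z \<phi> \<xi>]
  have "dist_le Q Y Z \<psi> ?r"
    using le_dist_residual_iff[OF X Y Z \<phi> \<xi> \<psi>] dist_le_refl[OF X Z \<xi>] by simp
  then have "dist_le Q X Z ?\<xi> (dist_comp Q X Y Z ?r \<phi>)"
    by (intro dist_comp_mono dist_le_refl X Y Z \<phi> \<psi> r)
  then show ?thesis
    by (rule dist_le_antisym[OF X Z dist_comp_families[OF X Y Z \<phi> r] \<xi> dist_residual_comp_le[OF X Y Z \<phi> \<xi>]])
qed

definition kan_interior ::
  "('a, 'o, 'm) qcat \<Rightarrow> ('b, 'o, 'm) qcat \<Rightarrow> ('a \<Rightarrow> 'b \<Rightarrow> 'm) \<Rightarrow> ('a, 'o, 'm) presheaf \<Rightarrow> ('a, 'o, 'm) presheaf"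
  where "kan_interior X Y \<phi> = compose (carrier (PSh Q X)) (kan_upper Q X Y \<phi>) (kan_lower Q X Y \<phi>)"

lemma Khat_ob_eq: "Khat_ob Q (X, Y, \<phi>) = (X, kan_interior X Y \<phi>)"
  by (simp add: Khat_ob_def kan_interior_def)

lemma kan_interior_simps:
  assumes "qcategory Q X" "qcategory Q Y" "distributor Q X Y \<phi>" "m \<in> presheaves Q X"
  shows "fst (kan_interior X Y \<phi> m) = fst m"
    and "snd (kan_interior X Y \<phi> m) =
      dist_comp Q X Y (point Q (fst m)) (dist_residual Q X Y (point Q (fst m)) (snd m) \<phi>) \<phi>"
  using assms kan_lower_presheaf[OF assms]
  by (simp_all add: kan_interior_def PSh_simps compose_eq kan_upper_simps kan_lower_simps)

lemma interior_space_kan_interior: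
  assumes X: "qcategory Q X" and Y: "qcategory Q Y" and \<phi>: "distributor Q X Y \<phi>"
  shows "interior_space Q (X, kan_interior X Y \<phi>)"
  unfolding interior_space_iff
proof (intro conjI ballI)
  let ?k = "kan_interior X Y \<phi>"
  show k: "qfunctor Q (PSh Q X) (PSh Q X) ?k"
    unfolding kan_interior_def
    by (rule qfunctor_PSh_compose[OF X Y X qfunctor_kan_lower[OF X Y \<phi>] qfunctor_kan_upper[OF X Y \<phi>]])
  fix m assume m: "m \<in> presheaves Q X"
  note P = presheaf_point[OF m] and \<phi>' = distributor_families[OF \<phi>]
  note k_simps = kan_interior_simps[OF X Y \<phi>]
  show "dist_le Q X (point Q (fst m)) (snd (?k m)) (snd m)"
    by (simp add: k_simps m dist_residual_comp_le[OF X Y P \<phi>' presheaf_families[OF m]])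
  have "?k m \<in> presheaves Q X" using k m unfolding qfunctor_PSh_iff[OF X X] by auto
  \<comment> \<open>The value \<open>?k m\<close> factors through \<open>\<phi>\<close> by
    construction, hence is fixed.\<close>
  then show "?k (?k m) = ?k m"
    using dist_comp_residual_comp[OF X Y P \<phi>' dist_residual_families[OF X Y P \<phi>' presheaf_families[OF m]]]
    by (intro prod_eqI) (simp_all add: k_simps m)
qed (rule X)

text \<open>The meeting point of both halves: commuting squares imply this inequality of composites
  and residuals, and its instances at columns produce a square.\<close>

lemma continuous_dist_kan_interior_iff:
  assumes X: "qcategory Q X" and Y: "qcategory Q Y" and \<phi>: "distributor Q X Y \<phi>"
    and X': "qcategory Q X'" and Y': "qcategory Q Y'" and \<psi>: "distributor Q X' Y' \<psi>"
  shows "continuous_dist Q (X, kan_interior X Y \<phi>) (X', kan_interior X' Y' \<psi>) \<zeta> \<longleftrightarrow>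
    distributor Q X X' \<zeta> \<and> (\<forall>l \<in> presheaves Q X'. dist_le Q X (point Q (fst l))
      (dist_comp Q X X' (point Q (fst l)) (dist_comp Q X' Y' (point Q (fst l))
        (dist_residual Q X' Y' (point Q (fst l)) (snd l) \<psi>) \<psi>) \<zeta>)
      (dist_comp Q X Y (point Q (fst l)) (dist_residual Q X Y (point Q (fst l))
        (dist_comp Q X X' (point Q (fst l)) (snd l) \<zeta>) \<phi>) \<phi>))"
  unfolding continuous_dist_iff[OF interior_space_kan_interior[OF X Y \<phi>] interior_space_kan_interior[OF X' Y' \<psi>]]
  by (auto simp: kan_interior_simps[OF X' Y' \<psi>] kan_interior_simps[OF X Y \<phi> kan_upper_presheaf[OF X X']] kan_upper_simps)

lemma continuous_dist_square:
  assumes X: "qcategory Q X" and Y: "qcategory Q Y" and \<phi>: "distributor Q X Y \<phi>"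
    and X': "qcategory Q X'" and Y': "qcategory Q Y'" and \<psi>: "distributor Q X' Y' \<psi>"
    and \<zeta>: "distributor Q X X' \<zeta>" and \<eta>: "distributor Q Y Y' \<eta>"
    and sq: "dist_comp Q X X' Y' \<psi> \<zeta> = dist_comp Q X Y Y' \<eta> \<phi>"
  shows "continuous_dist Q (X, kan_interior X Y \<phi>) (X', kan_interior X' Y' \<psi>) \<zeta>"
  unfolding continuous_dist_kan_interior_iff[OF X Y \<phi> X' Y' \<psi>]
proof (intro conjI ballI \<zeta>)
  note f = \<phi>[THEN distributor_families] \<psi>[THEN distributor_families]
    \<zeta>[THEN distributor_families] \<eta>[THEN distributor_families]
  fix l assume l: "l \<in> presheaves Q X'"
  let ?P = "point Q (fst l)"
  note P = presheaf_point[OF l] and l' = presheaf_families[OF l]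
  let ?r = "dist_residual Q X' Y' ?P (snd l) \<psi>"
  note r = dist_residual_families[OF X' Y' P f(2) l']
  note r\<eta> = dist_comp_families[OF Y Y' P f(4) r]
  note l\<zeta> = dist_comp_families[OF X X' P f(3) l']
  \<comment> \<open>The square turns a composite starting with \<open>\<zeta>\<close> into one
    starting with \<open>\<phi>\<close>, which can be transposed along
    \<open>\<phi>\<close>.\<close>
  have eq: "dist_comp Q X X' ?P (dist_comp Q X' Y' ?P ?r \<psi>) \<zeta> = dist_comp Q X Y ?P (dist_comp Q Y Y' ?P ?r \<eta>) \<phi>"
    using dist_comp_assoc[OF X X' Y' P f(3,2) r] dist_comp_assoc[OF X Y Y' P f(1,4) r] sq by simp
  have "dist_le Q X ?P (dist_comp Q X X' ?P (dist_comp Q X' Y' ?P ?r \<psi>) \<zeta>) (dist_comp Q X X' ?P (snd l) \<zeta>)"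
    by (intro dist_comp_mono dist_le_refl dist_residual_comp_le dist_comp_families[OF X' Y' P f(2) r] X X' Y' P f l')
  then have "dist_le Q Y ?P (dist_comp Q Y Y' ?P ?r \<eta>) (dist_residual Q X Y ?P (dist_comp Q X X' ?P (snd l) \<zeta>) \<phi>)"
    unfolding eq le_dist_residual_iff[OF X Y P f(1) l\<zeta> r\<eta>] .
  then show "dist_le Q X ?P (dist_comp Q X X' ?P (dist_comp Q X' Y' ?P ?r \<psi>) \<zeta>)
      (dist_comp Q X Y ?P (dist_residual Q X Y ?P (dist_comp Q X X' ?P (snd l) \<zeta>) \<phi>) \<phi>)"
    unfolding eq by (intro dist_comp_mono dist_le_refl dist_residual_families X Y P f(1) l\<zeta> r\<eta>)
qed

section \<open>Columns of a distributor as presheaves, and fullness\<close>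

definition column :: "('a, 'o, 'm) qcat \<Rightarrow> 'b \<Rightarrow> ('a \<Rightarrow> 'b \<Rightarrow> 'm) \<Rightarrow> 'a \<Rightarrow> unit \<Rightarrow> 'm" where
  "column X y \<phi> = (\<lambda>x \<in> carrier X. \<lambda>_. \<phi> x y)"

text \<open>In a composite the last index is a mere parameter. This and its analogue for residuals
  carry an equation about a whole distributor over to the presheaf at one index.\<close>

lemma dist_comp_column:
  assumes "z \<in> carrier Z"
  shows "dist_comp Q X Y (point Q (ty Z z)) (column Y z \<psi>) \<phi> = column X z (dist_comp Q X Y Z \<psi> \<phi>)"
  using assms by (auto simp: fun_eq_iff dist_comp_def column_def cong: image_cong)

lemma dist_residual_column:
  assumes "z \<in> carrier Z"
  shows "dist_residual Q X Y (point Q (ty Z z)) (column X z \<xi>) \<phi> = column Y z (dist_residual Q X Y Z \<xi> \<phi>)"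
  using assms by (auto simp: fun_eq_iff dist_residual_def column_def cong: image_cong)

text \<open>The action of \<open>X\<close> on a column is inherited from \<open>\<phi>\<close>, and
  the action of the point is trivial. The presheaf has type \<open>ty Y y\<close>, which varies with
  the column.\<close>

lemma column_presheaf:
  assumes X: "qcategory Q X" and Y: "qcategory Q Y" and \<phi>: "distributor Q X Y \<phi>" and y: "y \<in> carrier Y"
  shows "(ty Y y, column X y \<phi>) \<in> presheaves Q X"
proof -
  have q: "ty Y y \<in> Ob Q" using Y y by (rule qcategory_ty)
  note P = qcategory_point[OF q]
  have col: "column X y \<phi> \<in> families Q X (point Q (ty Y y))"
    using families_arrow[OF distributor_families[OF \<phi>] _ y] by (auto simp: column_def families_def)
  have "dist_comp Q X X (point Q (ty Y y)) (column X y \<phi>) (hm X) = column X y \<phi>"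
    by (simp add: dist_comp_column[OF y] dist_comp_hm_right[OF X Y \<phi>])
  then show ?thesis
    using q dist_le_refl[OF X P col] dist_comp_point[OF X q col] col
    by (simp add: presheaves_iff distributor_iff[OF X P])
qed

text \<open>
  The square is filled by the largest candidate, the residual of \<open>\<psi> \<circ> \<zeta>\<close> along \<open>\<phi>\<close>;
  continuity at the columns of \<open>\<psi>\<close>, which are fixed points of the interior operator of \<open>\<psi>\<close>,
  says exactly that it commutes.
\<close>

lemma continuous_dist_lift:
  assumes X: "qcategory Q X" and Y: "qcategory Q Y" and \<phi>: "distributor Q X Y \<phi>"
    and X': "qcategory Q X'" and Y': "qcategory Q Y'" and \<psi>: "distributor Q X' Y' \<psi>"
    and \<zeta>: "continuous_dist Q (X, kan_interior X Y \<phi>) (X', kan_interior X' Y' \<psi>) \<zeta>"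
  shows "\<exists>\<eta>. distributor Q Y Y' \<eta> \<and> dist_comp Q X X' Y' \<psi> \<zeta> = dist_comp Q X Y Y' \<eta> \<phi>"
proof (intro exI conjI)
  have d\<zeta>: "distributor Q X X' \<zeta>" using \<zeta> by (simp add: continuous_dist_def)
  note f = \<phi>[THEN distributor_families] \<psi>[THEN distributor_families] d\<zeta>[THEN distributor_families]
  let ?\<xi> = "dist_comp Q X X' Y' \<psi> \<zeta>"
  let ?\<eta> = "dist_residual Q X Y Y' ?\<xi> \<phi>"
  have \<xi>: "distributor Q X Y' ?\<xi>" by (rule distributor_dist_comp[OF X X' Y' d\<zeta> \<psi>])
  note \<xi>' = distributor_families[OF \<xi>]
  show \<eta>: "distributor Q Y Y' ?\<eta>" by (rule distributor_dist_residual[OF X Y Y' \<phi> \<xi>])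
  \<comment> \<open>The distributor \<open>\<psi>\<close> factors through itself as
    \<open>hm Y' \<circ> \<psi>\<close>, so the triangle identity applies with \<open>hm Y'\<close>
    as the other factor.\<close>
  have \<psi>_eq: "dist_comp Q X' Y' Y' (dist_residual Q X' Y' Y' \<psi> \<psi>) \<psi> = \<psi>"
    using dist_comp_residual_comp[OF X' Y' Y' f(2) hm_families[OF Y']] dist_comp_hm_left[OF X' Y' \<psi>]
    by simp
  have "?\<xi> x y' \<sqsubseteq>\<^bsub>Hom Q (ty X x) (ty Y' y')\<^esub> dist_comp Q X Y Y' ?\<eta> \<phi> x y'"
    if x: "x \<in> carrier X" and y': "y' \<in> carrier Y'" for x y'
  proof -
    \<comment> \<open>Continuity is instantiated at the presheaf \<open>column X' y' \<psi>\<close>.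
      The column rules move the column outside on both sides, and \<open>\<psi>_eq\<close> removes
      the interior operator on the left.\<close>
    have "dist_le Q X (point Q (ty Y' y')) (column X y' ?\<xi>) (column X y' (dist_comp Q X Y Y' ?\<eta> \<phi>))"
      using \<zeta>[unfolded continuous_dist_kan_interior_iff[OF X Y \<phi> X' Y' \<psi>]] column_presheaf[OF X' Y' \<psi> y']
      by (force simp: dist_comp_column[OF y'] dist_residual_column[OF y'] \<psi>_eq)
    then show ?thesis using x by (simp add: dist_le_def column_def)
  qed
  then have "dist_le Q X Y' ?\<xi> (dist_comp Q X Y Y' ?\<eta> \<phi>)"
    by (simp add: dist_le_def)
  \<comment> \<open>The opposite inequality is the counit of residuation.\<close>
  then show "?\<xi> = dist_comp Q X Y Y' ?\<eta> \<phi>"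
    by (rule dist_le_antisym[OF X Y' \<xi>' dist_comp_families[OF X Y Y' f(1) distributor_families[OF \<eta>]]
          _ dist_residual_comp_le[OF X Y Y' f(1) \<xi>']])
qed

end

theorem proposition5p4:
  fixes Q :: "('o, 'm) quantaloid_struct"
  assumes "quantaloid Q"
  shows "full_quantaloid_hom
    (Arr (QDist Q :: (('a, 'o, 'm) qcat, 'a \<Rightarrow> 'a \<Rightarrow> 'm) quantaloid_struct))
    (IntDist Q :: (('a, 'o, 'm) ispace, 'a \<Rightarrow> 'a \<Rightarrow> 'm) quantaloid_struct)
    (Khat_ob Q) Khat_arr"
proof -
  let ?D = "QDist Q :: (('a, 'o, 'm) qcat, 'a \<Rightarrow> 'a \<Rightarrow> 'm) quantaloid_struct"
  let ?A = "Arr ?D"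
  let ?I = "IntDist Q :: (('a, 'o, 'm) ispace, 'a \<Rightarrow> 'a \<Rightarrow> 'm) quantaloid_struct"
  interpret quantaloid Q by fact
  \<comment> \<open>The locale to be established contains the claim that both ends are quantaloids;
    the interpretations supply this, with \<open>?A\<close> and \<open>?I\<close> both built over
    \<open>?D\<close>.\<close>
  interpret D: quantaloid ?D by (rule quantaloid_QDist)
  interpret A: quantaloid ?A by (rule D.quantaloid_Arr)
  interpret over: quantaloid_over ?D ?I fst by (rule quantaloid_over_IntDist)
  interpret I: quantaloid ?I by (rule over.quantaloid_A)
  have ob: "\<exists>X Y \<phi>. p = (X, Y, \<phi>) \<and> qcategory Q X \<and> qcategory Q Y \<and> distributor Q X Y \<phi>"
    if "p \<in> Ob ?A" for p
    using that by (cases p) (simp add: D.Arr_simps QDist_simps)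
  have fst_ob: "fst (Khat_ob Q p) = fst p" for p :: "('a, 'o, 'm) qcat \<times> ('a, 'o, 'm) qcat \<times> ('a \<Rightarrow> 'a \<Rightarrow> 'm)"
    by (cases p) (simp add: Khat_ob_eq)
  have arr_fst: "Khat_arr p q u = fst u"
    for p q :: "('a, 'o, 'm) qcat \<times> ('a, 'o, 'm) qcat \<times> ('a \<Rightarrow> 'a \<Rightarrow> 'm)" and u
    by (simp add: Khat_arr_def case_prod_beta)
  have map_ob: "Khat_ob Q p \<in> Ob ?I" if "p \<in> Ob ?A" for p
    using ob[OF that] by (auto simp: Khat_ob_eq IntDist_simps interior_space_kan_interior)
  have map_arrow: "fst u \<in> Arrows ?I (Khat_ob Q p) (Khat_ob Q q)"
    if p: "p \<in> Ob ?A" and q: "q \<in> Ob ?A" and u: "u \<in> Arrows ?A p q" for p q u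
  proof -
    obtain X Y \<phi> X' Y' \<psi> where *: "p = (X, Y, \<phi>)" "qcategory Q X" "qcategory Q Y" "distributor Q X Y \<phi>"
      "q = (X', Y', \<psi>)" "qcategory Q X'" "qcategory Q Y'" "distributor Q X' Y' \<psi>"
      using ob[OF p] ob[OF q] by blast
    obtain \<zeta> \<eta> where "u = (\<zeta>, \<eta>)" "distributor Q X X' \<zeta>" "distributor Q Y Y' \<eta>"
      "dist_comp Q X X' Y' \<psi> \<zeta> = dist_comp Q X Y Y' \<eta> \<phi>"
      using u by (auto simp: * D.Arr_simps QDist_simps)
    then show ?thesis
      using continuous_dist_square[OF *(2-4,6-8), of \<zeta> \<eta>] by (simp add: * Khat_ob_eq IntDist_simps)
  qed
  show ?thesis
  proof (unfold_locales, unfold arr_fst)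
    fix p q S
    assume p: "p \<in> Ob ?A" and q: "q \<in> Ob ?A" and S: "S \<subseteq> Arrows ?A p q"
    have "fst ` S \<subseteq> Arrows ?I (Khat_ob Q p) (Khat_ob Q q)"
      using map_arrow[OF p q] S by auto
    \<comment> \<open>Both sides become the join of the first components in \<open>?D\<close>: joins
      of squares are componentwise, and joins of continuous distributors are joins of
      distributors.\<close>
    from over.sup_eq_A[OF map_ob[OF p] map_ob[OF q] this]
    show "fst (\<Squnion>\<^bsub>Hom ?A p q\<^esub> S) = \<Squnion>\<^bsub>Hom ?I (Khat_ob Q p) (Khat_ob Q q)\<^esub> (fst ` S)"
      using p q S by (cases p; cases q) (simp add: fst_ob D.Arr_sup_eq D.Arr_simps(1))
  next
    fix p q w
    assume p: "p \<in> Ob ?A" and q: "q \<in> Ob ?A" and w: "w \<in> Arrows ?I (Khat_ob Q p) (Khat_ob Q q)"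
    obtain X Y \<phi> X' Y' \<psi> where *: "p = (X, Y, \<phi>)" "qcategory Q X" "qcategory Q Y" "distributor Q X Y \<phi>"
      "q = (X', Y', \<psi>)" "qcategory Q X'" "qcategory Q Y'" "distributor Q X' Y' \<psi>"
      using ob[OF p] ob[OF q] by blast
    then have c: "continuous_dist Q (X, kan_interior X Y \<phi>) (X', kan_interior X' Y' \<psi>) w"
      using w by (simp add: Khat_ob_eq IntDist_simps)
    then obtain \<eta> where "distributor Q Y Y' \<eta>" "dist_comp Q X X' Y' \<psi> w = dist_comp Q X Y Y' \<eta> \<phi>"
      using continuous_dist_lift * by blast
    with c have "(w, \<eta>) \<in> Arrows ?A p q"
      by (simp add: * D.Arr_simps QDist_simps continuous_dist_def)
    then show "\<exists>u\<in>Arrows ?A p q. fst u = w" by force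
  next
    fix p q r u v
    assume "p \<in> Ob ?A" "q \<in> Ob ?A" "r \<in> Ob ?A" "u \<in> Arrows ?A p q" "v \<in> Arrows ?A q r"
    show "fst (Comp ?A p q r v u) = Comp ?I (Khat_ob Q p) (Khat_ob Q q) (Khat_ob Q r) (fst v) (fst u)"
      by (cases p; cases q; cases r; cases u; cases v) (simp add: D.Arr_simps IntDist_simps Khat_ob_eq QDist_simps)
  next
    fix p show "fst (Idt ?A p) = Idt ?I (Khat_ob Q p)"
      by (cases p) (simp add: D.Arr_simps IntDist_simps Khat_ob_eq QDist_simps)
  qed (use map_ob map_arrow in auto)
qed

end
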